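(* Let $X$ be a Banach space, $A$ a Banach algebra, $x\in X$, and let $f_1, \dots, f_r: X \to A$ be $C^n$ near $x$, with $n \geq k$. For $v_1, \dots, v_k \in X$: (1) (Boolean product rule) $$D(f_1 \cdots f_r; x; v_{[k]}) = \sum_{J_1 \sqcup \cdots \sqcup J_r = [k]} D(f_1; x; v_{J_1}) \cdots D(f_r; x; v_{J_r}),$$ where the sum runs over all ordered partitions $(J_1,\dots,J_r)$ of $[k]$: the $J_a$ are pairwise disjoint and empty $J_a$ are allowed. (2) (Boolean Taylor product rule) The square-free part of the order-$n$ Taylor polynomial (at $t=0$) of $t \mapsto (f_1 \cdots f_r)(x + \sum_{i=1}^k t_i v_i)$ is $$\sum_{J_1 \sqcup \cdots \sqcup J_r \subseteq [k]} D(f_1; x; v_{J_1}) \cdots D(f_r; x; v_{J_r})\, t^{J_1 \sqcup \cdots \sqcup J_r}.$$ (3) (Binomial product rule) For $\gamma \in \mathbb{N}_0^k$ with $|\gamma| \leq n$: $$D(f_1 \cdots f_r; x; v_\bullet^{\times \gamma}) = \sum_{\alpha_1 + \cdots + \alpha_r = \gamma} \frac{\gamma!}{\alpha_1! \cdots \alpha_r!}\, D(f_1; x; v_\bullet^{\times \alpha_1}) \cdots D(f_r; x; v_\bullet^{\times \alpha_r}).$$ (4) (Binomial Taylor product rule) $$(f_1 \cdots f_r)\big(x + \textstyle\sum_i t_i v_i\big) = \sum_{\substack{\alpha_1, \dots, \alpha_r \geq 0 \\ |\alpha_1 + \cdots + \alpha_r| \leq n}} \frac{t^{\alpha_1 +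 \cdots + \alpha_r}}{\alpha_1! \cdots \alpha_r!}\, D(f_1; x; v_\bullet^{\times \alpha_1}) \cdots D(f_r; x; v_\bullet^{\times \alpha_r}) + o(|t|^n)\quad (t\to0).$$
   Context: $[k]=\{1,\dots,k\}$; $f_1\cdots f_r$ is the pointwise product. $D(f;x;w_1,\dots,w_j)=D^jf(x)[w_1,\dots,w_j]$ is the $j$-th Fréchet derivative in the given directions, with $D(f;x;\emptyset)=f(x)$. For $J\subseteq[k]$, $v_J=(v_i)_{i\in J}$; for $\alpha\in\mathbb{N}_0^k$, $v_\bullet^{\times\alpha}$ is the list with each $v_i$ repeated $\alpha_i$ times. The $\alpha_a$ range over multi-indices in $\mathbb{N}_0^k$, $|\alpha|=\sum_i\alpha_i$, $\alpha!=\prod_i\alpha_i!$, $t^\alpha=\prod_it_i^{\alpha_i}$, $t^J=\prod_{i\in J}t_i$. In (2) the sum is over all tuples of pairwise disjoint (possibly empty) subsets of $[k]$, and the square-free part of a polynomial in $t_1,\dots,t_k$ is the sum of its terms in monomials $t^J$, $J\subseteq[k]$. *)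

theory Defs
  imports "HOL-Analysis.Analysis" "HOL-Library.Poly_Mapping" "HOL-Library.Landau_Symbols"
begin

text \<open>
  The \<open>j\<close>-th derivative of \<open>f : X \<rightarrow> A\<close> takes values in the space \<open>L\<^sup>j(X; A)\<close> of bounded \<open>j\<close>-linear
  maps, with the operator norm. As the target space changes with \<open>j\<close>, all orders are put into one
  normed space, the \<open>\<ell>\<^sup>\<infinity>\<close>-sum of the spaces \<open>L\<^sup>j(X; A)\<close>: an element assigns to each list of
  directions a value, multilinearly in the directions for each length of the list, and with a
  common bound for all lengths. \<open>L\<^sup>j(X; A)\<close> sits in it isometrically as the elements that vanish
  on all lists of length other than \<open>j\<close>.
\<close>

definition bounded_multilinear ::
  "('a::real_normed_vector list \<Rightarrow> 'b::real_normed_vector) \<Rightarrow> bool" where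
  "bounded_multilinear T \<longleftrightarrow>
     (\<forall>us ws. linear (\<lambda>v. T (us @ v # ws))) \<and>
     (\<exists>K. \<forall>vs. norm (T vs) \<le> K * (\<Prod>v\<leftarrow>vs. norm v))"

lemma bounded_multilinearI:
  assumes "\<And>us ws. linear (\<lambda>v. T (us @ v # ws))"
    and "\<And>vs. norm (T vs) \<le> K * (\<Prod>v\<leftarrow>vs. norm v)"
  shows "bounded_multilinear T"
  using assms unfolding bounded_multilinear_def by blast

lemma bounded_multilinear_zero: "bounded_multilinear (\<lambda>_. 0)"
  by (rule bounded_multilinearI[where K = 0]) (simp_all add: linear_zero)

lemma prod_list_norm_nonneg: "0 \<le> (\<Prod>v\<leftarrow>vs. norm v)"
  by (induction vs) auto

lemma bounded_multilinear_add:
  assumes "bounded_multilinear S" "bounded_multilinear T"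
  shows "bounded_multilinear (\<lambda>vs. S vs + T vs)"
proof -
  obtain K L where K: "\<And>vs. norm (S vs) \<le> K * (\<Prod>v\<leftarrow>vs. norm v)"
    and L: "\<And>vs. norm (T vs) \<le> L * (\<Prod>v\<leftarrow>vs. norm v)"
    using assms unfolding bounded_multilinear_def by blast
  show ?thesis
  proof (rule bounded_multilinearI[where K = "K + L"])
    show "linear (\<lambda>v. S (us @ v # ws) + T (us @ v # ws))" for us ws
      using assms unfolding bounded_multilinear_def by (intro linear_compose_add) auto
    show "norm (S vs + T vs) \<le> (K + L) * (\<Prod>v\<leftarrow>vs. norm v)" for vs
      using norm_triangle_mono[OF K L, of vs vs] by (simp add: algebra_simps)
  qed
qed

lemma bounded_multilinear_scaleR:
  assumes "bounded_multilinear T"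
  shows "bounded_multilinear (\<lambda>vs. c *\<^sub>R T vs)"
proof -
  obtain K where K: "\<And>vs. norm (T vs) \<le> K * (\<Prod>v\<leftarrow>vs. norm v)"
    using assms unfolding bounded_multilinear_def by blast
  show ?thesis
  proof (rule bounded_multilinearI[where K = "\<bar>c\<bar> * K"])
    show "linear (\<lambda>v. c *\<^sub>R T (us @ v # ws))" for us ws
      using assms unfolding bounded_multilinear_def by (intro linear_compose_scale_right) auto
    show "norm (c *\<^sub>R T vs) \<le> \<bar>c\<bar> * K * (\<Prod>v\<leftarrow>vs. norm v)" for vs
      using mult_left_mono[OF K[of vs], of "\<bar>c\<bar>"] by (simp add: mult.assoc)
  qed
qed

lemma bounded_multilinear_minus:
  "bounded_multilinear T \<Longrightarrow> bounded_multilinear (\<lambda>vs. - T vs)"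
  using bounded_multilinear_scaleR[of T "-1"] by simp

lemma bounded_multilinear_diff:
  "bounded_multilinear S \<Longrightarrow> bounded_multilinear T \<Longrightarrow> bounded_multilinear (\<lambda>vs. S vs - T vs)"
  using bounded_multilinear_add[OF _ bounded_multilinear_minus, of S T] by simp

typedef (overloaded) ('a, 'b) mlin =
  "{T :: 'a::real_normed_vector list \<Rightarrow> 'b::real_normed_vector. bounded_multilinear T}"
  morphisms mlin_apply Mlin
  using bounded_multilinear_zero by blast

setup_lifting type_definition_mlin

definition mlin_norm :: "('a::real_normed_vector list \<Rightarrow> 'b::real_normed_vector) \<Rightarrow> real" where
  "mlin_norm T = (SUP vs. norm (T vs) / (\<Prod>v\<leftarrow>vs. norm v))"

lemma mlin_norm_bdd_above:
  assumes "bounded_multilinear T"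
  shows "bdd_above (range (\<lambda>vs. norm (T vs) / (\<Prod>v\<leftarrow>vs. norm v)))"
proof -
  obtain K where K: "\<And>vs. norm (T vs) \<le> K * (\<Prod>v\<leftarrow>vs. norm v)"
    using assms unfolding bounded_multilinear_def by blast
  have "norm (T vs) / (\<Prod>v\<leftarrow>vs. norm v) \<le> max K 0" for vs
  proof (cases "(\<Prod>v\<leftarrow>vs. norm v) = 0")
    case False
    then have "(\<Prod>v\<leftarrow>vs. norm v) > 0"
      using prod_list_norm_nonneg[of vs] by linarith
    then show ?thesis
      using order_trans[OF K[of vs] mult_right_mono[of K "max K 0"]] by (simp add: divide_le_eq)
  qed simp
  then show ?thesis by (intro bdd_aboveI) auto
qed

lemma mlin_norm:
  assumes "bounded_multilinear T"
  shows "norm (T vs) \<le> mlin_norm T * (\<Prod>v\<leftarrow>vs. norm v)"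
proof (cases "(\<Prod>v\<leftarrow>vs. norm v) = 0")
  case True
  obtain K where "norm (T vs) \<le> K * (\<Prod>v\<leftarrow>vs. norm v)"
    using assms unfolding bounded_multilinear_def by blast
  with True show ?thesis by simp
next
  case False
  then have "(\<Prod>v\<leftarrow>vs. norm v) > 0"
    using prod_list_norm_nonneg[of vs] by linarith
  moreover have "norm (T vs) / (\<Prod>v\<leftarrow>vs. norm v) \<le> mlin_norm T"
    unfolding mlin_norm_def by (intro cSUP_upper mlin_norm_bdd_above[OF assms]) simp
  ultimately show ?thesis by (simp add: divide_le_eq)
qed

lemma mlin_norm_le:
  assumes "0 \<le> K" "\<And>vs. norm (T vs) \<le> K * (\<Prod>v\<leftarrow>vs. norm v)"
  shows "mlin_norm T \<le> K"
  unfolding mlin_norm_def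
proof (rule cSUP_least)
  show "norm (T vs) / (\<Prod>v\<leftarrow>vs. norm v) \<le> K" for vs
    using assms prod_list_norm_nonneg[of vs]
    by (cases "(\<Prod>v\<leftarrow>vs. norm v) = 0") (auto simp: divide_le_eq)
qed simp

lemma mlin_norm_nonneg:
  assumes "bounded_multilinear T"
  shows "0 \<le> mlin_norm T"
  using mlin_norm[OF assms, of "[]"] norm_ge_zero[of "T []"] by (simp del: norm_ge_zero)

lemma mlin_norm_eq_0:
  assumes "bounded_multilinear T"
  shows "mlin_norm T = 0 \<longleftrightarrow> T = (\<lambda>_. 0)"
proof
  assume "mlin_norm T = 0"
  then show "T = (\<lambda>_. 0)" using mlin_norm[OF assms] by auto
qed (simp add: mlin_norm_def)

lemma mlin_norm_triangle:
  assumes "bounded_multilinear S" "bounded_multilinear T"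
  shows "mlin_norm (\<lambda>vs. S vs + T vs) \<le> mlin_norm S + mlin_norm T"
proof (rule mlin_norm_le)
  show "norm (S vs + T vs) \<le> (mlin_norm S + mlin_norm T) * (\<Prod>v\<leftarrow>vs. norm v)" for vs
    using norm_triangle_mono[OF mlin_norm[OF assms(1)] mlin_norm[OF assms(2)], of vs vs]
    by (simp add: algebra_simps)
qed (intro add_nonneg_nonneg mlin_norm_nonneg assms)

lemma mlin_norm_scaleR_le:
  assumes "bounded_multilinear T"
  shows "mlin_norm (\<lambda>vs. c *\<^sub>R T vs) \<le> \<bar>c\<bar> * mlin_norm T"
proof (rule mlin_norm_le)
  show "norm (c *\<^sub>R T vs) \<le> \<bar>c\<bar> * mlin_norm T * (\<Prod>v\<leftarrow>vs. norm v)" for vs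
    using mult_left_mono[OF mlin_norm[OF assms, of vs], of "\<bar>c\<bar>"] by (simp add: mult.assoc)
qed (intro mult_nonneg_nonneg abs_ge_zero mlin_norm_nonneg assms)

lemma mlin_norm_scaleR:
  assumes "bounded_multilinear T"
  shows "mlin_norm (\<lambda>vs. c *\<^sub>R T vs) = \<bar>c\<bar> * mlin_norm T"
proof (cases "c = 0")
  case False
  have "mlin_norm T \<le> \<bar>inverse c\<bar> * mlin_norm (\<lambda>vs. c *\<^sub>R T vs)"
    using mlin_norm_scaleR_le[OF bounded_multilinear_scaleR[OF assms, of c], of "inverse c"] False
    by simp
  then have "\<bar>c\<bar> * mlin_norm T \<le> mlin_norm (\<lambda>vs. c *\<^sub>R T vs)"
    using False by (simp add: field_simps)
  with mlin_norm_scaleR_le[OF assms, of c] show ?thesis by simp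
qed (simp add: mlin_norm_def)

instantiation mlin :: (real_normed_vector, real_normed_vector) real_normed_vector
begin

lift_definition norm_mlin :: "('a, 'b) mlin \<Rightarrow> real" is mlin_norm .

lift_definition zero_mlin :: "('a, 'b) mlin" is "\<lambda>_. 0"
  by (rule bounded_multilinear_zero)

lift_definition plus_mlin :: "('a, 'b) mlin \<Rightarrow> ('a, 'b) mlin \<Rightarrow> ('a, 'b) mlin"
  is "\<lambda>S T vs. S vs + T vs"
  by (rule bounded_multilinear_add)

lift_definition minus_mlin :: "('a, 'b) mlin \<Rightarrow> ('a, 'b) mlin \<Rightarrow> ('a, 'b) mlin"
  is "\<lambda>S T vs. S vs - T vs"
  by (rule bounded_multilinear_diff)

lift_definition uminus_mlin :: "('a, 'b) mlin \<Rightarrow> ('a, 'b) mlin" is "\<lambda>T vs. - T vs"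
  by (rule bounded_multilinear_minus)

lift_definition scaleR_mlin :: "real \<Rightarrow> ('a, 'b) mlin \<Rightarrow> ('a, 'b) mlin"
  is "\<lambda>c T vs. c *\<^sub>R T vs"
  by (rule bounded_multilinear_scaleR)

definition dist_mlin :: "('a, 'b) mlin \<Rightarrow> ('a, 'b) mlin \<Rightarrow> real"
  where "dist_mlin S T = norm (S - T)"

definition uniformity_mlin :: "(('a, 'b) mlin \<times> ('a, 'b) mlin) filter"
  where "uniformity_mlin = (INF e\<in>{0<..}. principal {(x, y). dist x y < e})"

definition open_mlin :: "('a, 'b) mlin set \<Rightarrow> bool"
  where "open_mlin U = (\<forall>x\<in>U. \<forall>\<^sub>F (x', y) in uniformity. x' = x \<longrightarrow> y \<in> U)"

definition sgn_mlin :: "('a, 'b) mlin \<Rightarrow> ('a, 'b) mlin"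
  where "sgn_mlin T = scaleR (inverse (norm T)) T"

instance
proof
  fix S T U :: "('a, 'b) mlin" and c d :: real
  show "S + T + U = S + (T + U)" by transfer (simp add: add.assoc)
  show "S + T = T + S" by transfer (simp add: add.commute)
  show "0 + S = S" by transfer simp
  show "- S + S = 0" by transfer simp
  show "S - T = S + - T" by transfer simp
  show "c *\<^sub>R (S + T) = c *\<^sub>R S + c *\<^sub>R T" by transfer (simp add: scaleR_add_right)
  show "(c + d) *\<^sub>R S = c *\<^sub>R S + d *\<^sub>R S" by transfer (simp add: scaleR_add_left)
  show "c *\<^sub>R d *\<^sub>R S = (c * d) *\<^sub>R S" by transfer simp
  show "1 *\<^sub>R S = S" by transfer simp
  show "dist S T = norm (S - T)" by (rule dist_mlin_def)
  show "sgn S = inverse (norm S) *\<^sub>R S" by (rule sgn_mlin_def)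
  show "(uniformity :: (('a, 'b) mlin \<times> ('a, 'b) mlin) filter) =
      (INF e\<in>{0<..}. principal {(x, y). dist x y < e})"
    by (rule uniformity_mlin_def)
  show "open W = (\<forall>x\<in>W. \<forall>\<^sub>F (x', y) in uniformity. x' = x \<longrightarrow> y \<in> W)"
    for W :: "('a, 'b) mlin set" by (rule open_mlin_def)
  show "norm S = 0 \<longleftrightarrow> S = 0" by transfer (rule mlin_norm_eq_0)
  show "norm (S + T) \<le> norm S + norm T" by transfer (rule mlin_norm_triangle)
  show "norm (c *\<^sub>R S) = \<bar>c\<bar> * norm S" by transfer (rule mlin_norm_scaleR)
qed

end

lemma norm_mlin_apply: "norm (mlin_apply T vs) \<le> norm T * (\<Prod>v\<leftarrow>vs. norm v)"
  by transfer (rule mlin_norm)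


lift_definition mlin_const :: "'b::real_normed_vector \<Rightarrow> ('a::real_normed_vector, 'b) mlin"
  is "\<lambda>c vs. if vs = [] then c else 0"
proof -
  fix c :: 'b
  show "bounded_multilinear (\<lambda>vs :: 'a list. if vs = [] then c else 0)"
    by (rule bounded_multilinearI[where K = "norm c"])
      (auto simp: linear_zero prod_list_norm_nonneg)
qed

text \<open>The identification of \<open>L(X; L\<^sup>j(X; A))\<close> with \<open>L\<^sup>j\<^sup>+\<^sup>1(X; A)\<close>\<close>

lift_definition mlin_uncurry ::
  "('a::real_normed_vector \<Rightarrow>\<^sub>L ('a, 'b::real_normed_vector) mlin) \<Rightarrow> ('a, 'b) mlin"
  is "\<lambda>L vs. case vs of [] \<Rightarrow> 0 | w # ws \<Rightarrow> mlin_apply (blinfun_apply L w) ws"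
proof -
  fix L :: "'a \<Rightarrow>\<^sub>L ('a, 'b) mlin"
  show "bounded_multilinear
    (\<lambda>vs. case vs of [] \<Rightarrow> 0 | w # ws \<Rightarrow> mlin_apply (blinfun_apply L w) ws)" (is "bounded_multilinear ?T")
  proof (rule bounded_multilinearI[where K = "norm L"])
    fix us ws :: "'a list"
    show "linear (\<lambda>v. ?T (us @ v # ws))"
    proof (cases us)
      case Nil
      then show ?thesis
        by (auto intro!: linearI
            simp: blinfun.add_right blinfun.scaleR_right plus_mlin.rep_eq scaleR_mlin.rep_eq)
    next
      case (Cons u us')
      then show ?thesis
        using mlin_apply[of "blinfun_apply L u"] by (auto simp: bounded_multilinear_def)
    qed
  next
    fix vs :: "'a list"
    show "norm (?T vs) \<le> norm L * (\<Prod>v\<leftarrow>vs. norm v)"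
    proof (cases vs)
      case (Cons w ws)
      have "norm (?T vs) \<le> norm (blinfun_apply L w) * (\<Prod>v\<leftarrow>ws. norm v)"
        using Cons norm_mlin_apply by auto
      also have "\<dots> \<le> (norm L * norm w) * (\<Prod>v\<leftarrow>ws. norm v)"
        by (intro mult_right_mono norm_blinfun prod_list_norm_nonneg)
      finally show ?thesis using Cons by (simp add: mult.assoc)
    qed simp
  qed
qed

text \<open>
  \<open>nth_deriv j f\<close> is the map \<open>D\<^sup>jf : X \<rightarrow> L\<^sup>j(X; A)\<close>, with \<open>D\<^sup>j\<^sup>+\<^sup>1f = D(D\<^sup>jf)\<close>. It is meaningful only at
  points where the derivatives exist.
\<close>

primrec nth_deriv ::
  "nat \<Rightarrow> ('a::real_normed_vector \<Rightarrow> 'b::real_normed_vector) \<Rightarrow> 'a \<Rightarrow> ('a, 'b) mlin" where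
  "nth_deriv 0 f = (\<lambda>y. mlin_const (f y))"
| "nth_deriv (Suc j) f =
     (\<lambda>y. mlin_uncurry (Blinfun (frechet_derivative (nth_deriv j f) (at y))))"

definition C_near :: "nat \<Rightarrow> ('a::real_normed_vector \<Rightarrow> 'b::real_normed_vector) \<Rightarrow> 'a \<Rightarrow> bool" where
  "C_near n f x \<longleftrightarrow>
     (\<exists>U. open U \<and> x \<in> U \<and>
        (\<forall>j<n. \<forall>y\<in>U. nth_deriv j f differentiable (at y)) \<and>
        continuous_on U (nth_deriv n f))"

definition dir_deriv ::
  "('a::real_normed_vector \<Rightarrow> 'b::real_normed_vector) \<Rightarrow> 'a \<Rightarrow> 'a list \<Rightarrow> 'b" where
  "dir_deriv f x ws = mlin_apply (nth_deriv (length ws) f x) ws"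

lemma dir_deriv_Nil: "dir_deriv f x [] = f x"
  by (simp add: dir_deriv_def mlin_const.rep_eq)

lemma dir_deriv_Cons:
  assumes "nth_deriv (length ws) f differentiable (at x)"
  shows "((\<lambda>y. dir_deriv f y ws) has_derivative (\<lambda>w. dir_deriv f x (w # ws))) (at x)"
proof -
  have lin: "bounded_linear (\<lambda>T. mlin_apply T ws)"
    by (rule bounded_linear_intro[where K = "\<Prod>v\<leftarrow>ws. norm v"])
      (simp_all add: plus_mlin.rep_eq scaleR_mlin.rep_eq norm_mlin_apply)
  have D: "(nth_deriv (length ws) f has_derivative
      frechet_derivative (nth_deriv (length ws) f) (at x)) (at x)"
    using assms frechet_derivative_works by blast
  show ?thesis
    using bounded_linear.has_derivative[OF lin D]
    by (simp add: dir_deriv_def mlin_uncurry.rep_eq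
        bounded_linear_Blinfun_apply[OF has_derivative_bounded_linear[OF D]])
qed


text \<open>
  The index set \<open>[k]\<close> is \<open>{1..k}\<close>; multi-indices in \<open>\<nat>\<^sub>0\<^sup>k\<close> are the finitely supported functions
  \<open>nat \<Rightarrow>\<^sub>0 nat\<close> with support in \<open>{1..k}\<close>. Points \<open>t\<close> of \<open>\<real>\<^sup>k\<close> are functions \<open>nat \<Rightarrow> real\<close> of which only
  the values on \<open>{1..k}\<close> are used.
\<close>

definition multi_indices :: "nat \<Rightarrow> (nat \<Rightarrow>\<^sub>0 nat) set" where
  "multi_indices k = {\<alpha>. Poly_Mapping.keys \<alpha> \<subseteq> {1..k}}"

definition mi_size :: "nat \<Rightarrow> (nat \<Rightarrow>\<^sub>0 nat) \<Rightarrow> nat" where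
  "mi_size k \<alpha> = (\<Sum>i = 1..k. Poly_Mapping.lookup \<alpha> i)"

definition mi_fact :: "nat \<Rightarrow> (nat \<Rightarrow>\<^sub>0 nat) \<Rightarrow> real" where
  "mi_fact k \<alpha> = (\<Prod>i = 1..k. fact (Poly_Mapping.lookup \<alpha> i))"

definition mi_power :: "nat \<Rightarrow> (nat \<Rightarrow> real) \<Rightarrow> (nat \<Rightarrow>\<^sub>0 nat) \<Rightarrow> real" where
  "mi_power k t \<alpha> = (\<Prod>i = 1..k. t i ^ Poly_Mapping.lookup \<alpha> i)"

text \<open>
  The derivatives are symmetric, so the order of a list of directions is immaterial; all lists
  below are in increasing order of the index.
\<close>

definition mi_list :: "nat \<Rightarrow> (nat \<Rightarrow>\<^sub>0 nat) \<Rightarrow> nat list" where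
  "mi_list k \<alpha> = concat (map (\<lambda>i. replicate (Poly_Mapping.lookup \<alpha> i) i) [1..<Suc k])"

definition dirs_set :: "(nat \<Rightarrow> 'a) \<Rightarrow> nat set \<Rightarrow> 'a list" where
  "dirs_set v J = map v (sorted_list_of_set J)"

definition dirs_rep :: "nat \<Rightarrow> (nat \<Rightarrow> 'a) \<Rightarrow> (nat \<Rightarrow>\<^sub>0 nat) \<Rightarrow> 'a list" where
  "dirs_rep k v \<alpha> = map v (mi_list k \<alpha>)"

text \<open>
  The product \<open>g\<^sub>1 \<cdots> g\<^sub>r\<close>, for \<open>r \<ge> 1\<close>, in this order: the algebra need not be commutative or have
  a unit.
\<close>

fun ordered_prod :: "(nat \<Rightarrow> 'b::semigroup_mult) \<Rightarrow> nat \<Rightarrow> 'b" where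
  "ordered_prod g 0 = undefined"
| "ordered_prod g (Suc 0) = g 1"
| "ordered_prod g (Suc (Suc m)) = ordered_prod g (Suc m) * g (Suc (Suc m))"

definition pointwise_prod :: "(nat \<Rightarrow> 'a \<Rightarrow> 'b::semigroup_mult) \<Rightarrow> nat \<Rightarrow> 'a \<Rightarrow> 'b" where
  "pointwise_prod f r = (\<lambda>y. ordered_prod (\<lambda>a. f a y) r)"

text \<open>
  A polynomial with coefficients in \<open>'b\<close> is a finitely supported function on monomials, and the
  monomial \<open>t\<^sup>\<alpha>\<close> is given by its exponent \<open>\<alpha>\<close>. \<open>sqfree_mono J\<close> is the exponent of \<open>t\<^sup>J\<close>.
\<close>

definition sqfree_mono :: "nat set \<Rightarrow> (nat \<Rightarrow>\<^sub>0 nat)" where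
  "sqfree_mono J = (\<Sum>i\<in>J. Poly_Mapping.single i 1)"

definition sqfree_part :: "nat \<Rightarrow> ((nat \<Rightarrow>\<^sub>0 nat) \<Rightarrow>\<^sub>0 'b::comm_monoid_add) \<Rightarrow> ((nat \<Rightarrow>\<^sub>0 nat) \<Rightarrow>\<^sub>0 'b)" where
  "sqfree_part k p =
     (\<Sum>J\<in>Pow {1..k}. Poly_Mapping.single (sqfree_mono J) (Poly_Mapping.lookup p (sqfree_mono J)))"

definition partial_deriv ::
  "nat \<Rightarrow> ((nat \<Rightarrow> real) \<Rightarrow> 'b::real_normed_vector) \<Rightarrow> (nat \<Rightarrow> real) \<Rightarrow> 'b" where
  "partial_deriv i g t = vector_derivative (\<lambda>s. g (t(i := s))) (at (t i))"

text \<open>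
  \<open>\<partial>\<^sup>\<alpha> = \<partial>\<^sub>1 \<cdots> \<partial>\<^sub>1 \<partial>\<^sub>2 \<cdots> \<partial>\<^sub>k \<cdots> \<partial>\<^sub>k\<close>, with \<open>\<partial>\<^sub>k\<close> applied first.
\<close>

definition mi_partial ::
  "nat \<Rightarrow> (nat \<Rightarrow>\<^sub>0 nat) \<Rightarrow> ((nat \<Rightarrow> real) \<Rightarrow> 'b::real_normed_vector) \<Rightarrow> (nat \<Rightarrow> real) \<Rightarrow> 'b" where
  "mi_partial k \<alpha> g = foldr partial_deriv (mi_list k \<alpha>) g"

definition taylor_poly ::
  "nat \<Rightarrow> nat \<Rightarrow> ((nat \<Rightarrow> real) \<Rightarrow> 'b::real_normed_vector) \<Rightarrow> ((nat \<Rightarrow>\<^sub>0 nat) \<Rightarrow>\<^sub>0 'b)" where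
  "taylor_poly k n g =
     (\<Sum>\<alpha> | \<alpha> \<in> multi_indices k \<and> mi_size k \<alpha> \<le> n.
        Poly_Mapping.single \<alpha> ((1 / mi_fact k \<alpha>) *\<^sub>R mi_partial k \<alpha> g (\<lambda>_. 0)))"

definition rk_norm :: "nat \<Rightarrow> (nat \<Rightarrow> real) \<Rightarrow> real" where
  "rk_norm k t = L2_set t {1..k}"

text \<open>
  The limit \<open>t \<rightarrow> 0\<close> in \<open>\<real>\<^sup>k\<close>; \<open>t = 0\<close> is not excluded, so the case \<open>k = 0\<close> is not vacuous.
\<close>

definition rk_zero_filter :: "nat \<Rightarrow> (nat \<Rightarrow> real) filter" where
  "rk_zero_filter k = filtercomap (rk_norm k) (nhds 0)"

end

theory Submission
  imports Defs
begin

text \<open>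
  The \<open>j\<close>-th derivative of a product of two factors is the sum, over all ways to distribute the \<open>j\<close>
  directions among the factors, of the products of the corresponding derivatives. Read as an identity
  between multilinear maps, this says that \<open>D\<^sup>m(f g)\<close> is a bounded bilinear expression in the
  derivatives of \<open>f\<close> and \<open>g\<close> up to order \<open>m\<close> (\<open>nth_deriv_mult\<close>). Hence it is differentiable for
  \<open>m < n\<close> and continuous for \<open>m = n\<close>, in the operator norm: a product of \<open>C\<^sup>n\<close> functions is \<open>C\<^sup>n\<close>.

  Once this is known, the formulas are identities between vectors of the algebra. Differentiating a
  sum of products of derivatives in one further direction distributes that direction over the
  factors (\<open>leibniz_step\<close>). When the directions are indexed by a set, the new index joins one of the
  blocks of an ordered partition (\<open>boolean_product_rule\<close>). When they are indexed by a multi-index,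
  several of these choices lead to the same decomposition, and Pascal's rule for multinomial
  coefficients (\<open>sum_decompositions_add_single\<close>) counts them (\<open>binomial_product_rule\<close>).

  The Taylor forms follow by applying the Taylor formula to the product itself and inserting these
  values of its derivatives. The square-free coefficients are the derivatives in the directions
  \<open>v\<^sub>J\<close> (\<open>sqfree_part_taylor_poly\<close>), as \<open>\<alpha>! = 1\<close> for the exponent of \<open>t\<^sup>J\<close>; and
  \<open>\<Sum>\<^sub>\<gamma> t\<^sup>\<gamma>/\<gamma>! D(f\<^sub>1\<cdots>f\<^sub>r; x; v\<^sup>\<times>\<^sup>\<gamma>)\<close> turns into the stated sum because the factors \<open>\<gamma>!\<close> cancel.

  All lists of directions arise sorted. In the inductions a direction is added in front of a list,
  from the largest index to the smallest, and the Taylor formula with remainder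
  (\<open>taylor_coordinates\<close>) is obtained by expanding in the coordinates \<open>t\<^sub>k, \<dots>, t\<^sub>1\<close> one after
  the other, each time by the mean value inequality along a line.
\<close>

section \<open>Derivatives of a product, as multilinear maps\<close>

text \<open>
  Fixing the first direction, which undoes \<open>mlin_uncurry\<close>: the derivative of \<open>D\<^sup>jf\<close> at \<open>y\<close>
  in the direction \<open>w\<close> is \<open>D\<^sup>j\<^sup>+\<^sup>1f(y)\<close> with first argument \<open>w\<close>.
\<close>

lift_definition mlin_slice ::
  "('a::real_normed_vector, 'b::real_normed_vector) mlin \<Rightarrow> 'a \<Rightarrow> ('a, 'b) mlin"
  is "\<lambda>T w vs. T (w # vs)"
proof -
  fix T :: "'a list \<Rightarrow> 'b" and w
  assume T: "bounded_multilinear T"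
  show "bounded_multilinear (\<lambda>vs. T (w # vs))"
  proof (rule bounded_multilinearI[where K = "mlin_norm T * norm w"])
    show "linear (\<lambda>v. T (w # us @ v # ws))" for us ws
    proof -
      have "linear (\<lambda>v. T ((w # us) @ v # ws))"
        using T unfolding bounded_multilinear_def by blast
      then show ?thesis by simp
    qed
    show "norm (T (w # vs)) \<le> mlin_norm T * norm w * (\<Prod>v\<leftarrow>vs. norm v)" for vs
      using mlin_norm[OF T, of "w # vs"] by (simp add: mult.assoc)
  qed
qed

lemma mlin_eqI: "(\<And>ws. mlin_apply S ws = mlin_apply T ws) \<Longrightarrow> S = T"
  by (rule iffD1[OF mlin_apply_inject]) (rule ext)

lemma bounded_linear_mlin_apply: "bounded_linear (\<lambda>T. mlin_apply T ws)"
  by (rule bounded_linear_intro[where K = "\<Prod>v\<leftarrow>ws. norm v"])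
    (simp_all add: plus_mlin.rep_eq scaleR_mlin.rep_eq norm_mlin_apply)

lemma mlin_apply_sum: "mlin_apply (sum S I) ws = (\<Sum>i\<in>I. mlin_apply (S i) ws)"
  by (rule linear_sum[OF bounded_linear.linear[OF bounded_linear_mlin_apply]])

lemma nth_deriv_Suc_Nil: "mlin_apply (nth_deriv (Suc j) f y) [] = 0"
  by (simp add: mlin_uncurry.rep_eq)

lemma nth_deriv_Suc_Cons:
  assumes "(nth_deriv j f has_derivative D) (at y)"
  shows "mlin_apply (nth_deriv (Suc j) f y) (w # ws) = mlin_apply (D w) ws"
  using frechet_derivative_at[OF assms]
    bounded_linear_Blinfun_apply[OF has_derivative_bounded_linear[OF assms]]
  by (simp add: mlin_uncurry.rep_eq)

lemma has_derivative_nth_deriv: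
  assumes "nth_deriv j f differentiable (at y)"
  shows "(nth_deriv j f has_derivative mlin_slice (nth_deriv (Suc j) f y)) (at y)"
proof -
  obtain D where D: "(nth_deriv j f has_derivative D) (at y)"
    using assms unfolding differentiable_def by blast
  have "D = mlin_slice (nth_deriv (Suc j) f y)"
    by (intro ext mlin_eqI) (simp add: mlin_slice.rep_eq nth_deriv_Suc_Cons[OF D] del: nth_deriv.simps)
  with D show ?thesis by simp
qed


text \<open>
  The sum of \<open>S us * T us'\<close> over all \<open>2\<^sup>m\<close> ways of splitting a list of length \<open>m\<close> into two
  complementary sublists \<open>us\<close> and \<open>us'\<close>, as in the Leibniz formula. The recursion decides to which
  factor the first direction goes, which is what one further differentiation does.
\<close>

fun shuffle ::
  "('a list \<Rightarrow> 'b) \<Rightarrow> ('a list \<Rightarrow> 'b) \<Rightarrow> 'a list \<Rightarrow> 'b::real_normed_algebra" where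
  "shuffle S T [] = S [] * T []"
| "shuffle S T (w # ws) = shuffle (\<lambda>us. S (w # us)) T ws + shuffle S (\<lambda>us. T (w # us)) ws"

lemma shuffle_cong:
  assumes "\<And>us. length us \<le> length ws \<Longrightarrow> S us = S' us"
    and "\<And>us. length us \<le> length ws \<Longrightarrow> T us = T' us"
  shows "shuffle S T ws = shuffle S' T' ws"
  using assms
proof (induction ws arbitrary: S T S' T')
  case (Cons w ws)
  show ?case
    unfolding shuffle.simps by (intro arg_cong2[of _ _ _ _ plus] Cons.IH) (auto intro: Cons.prems)
qed simp

lemma shuffle_add_left: "shuffle (\<lambda>us. S us + S' us) T ws = shuffle S T ws + shuffle S' T ws"
  by (induction ws arbitrary: S S' T) (simp_all add: distrib_right)

lemma shuffle_add_right: "shuffle S (\<lambda>us. T us + T' us) ws = shuffle S T ws + shuffle S T' ws"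
  by (induction ws arbitrary: S T T') (simp_all add: distrib_left)

lemma shuffle_scaleR_left: "shuffle (\<lambda>us. c *\<^sub>R S us) T ws = c *\<^sub>R shuffle S T ws"
  by (induction ws arbitrary: S T) (simp_all add: scaleR_add_right)

lemma shuffle_scaleR_right: "shuffle S (\<lambda>us. c *\<^sub>R T us) ws = c *\<^sub>R shuffle S T ws"
  by (induction ws arbitrary: S T) (simp_all add: scaleR_add_right)

lemma linear_shuffle:
  assumes "\<And>us ws. linear (\<lambda>v. S (us @ v # ws))" "\<And>us ws. linear (\<lambda>v. T (us @ v # ws))"
  shows "linear (\<lambda>v. shuffle S T (us @ v # ws))"
  using assms
proof (induction us arbitrary: S T)
  case Nil
  have S: "linear (\<lambda>v. S (v # us))" for us
    using Nil(1)[of "[]"] by simp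
  have T: "linear (\<lambda>v. T (v # us))" for us
    using Nil(2)[of "[]"] by simp
  show ?case
    by (rule linearI)
      (simp_all add: linear_add[OF S] linear_add[OF T] linear_scale[OF S] linear_scale[OF T]
        shuffle_add_left shuffle_add_right shuffle_scaleR_left shuffle_scaleR_right scaleR_add_right)
next
  case (Cons u us)
  have "linear (\<lambda>v. shuffle (\<lambda>us. S (u # us)) T (us @ v # ws) + shuffle S (\<lambda>us. T (u # us)) (us @ v # ws))"
    using Cons.prems(1)[of "u # _"] Cons.prems(2)[of "u # _"]
    by (intro linear_compose_add Cons.IH Cons.prems) simp_all
  then show ?case by simp
qed

lemma norm_shuffle_le:
  assumes "\<And>us. norm (S us) \<le> K * (\<Prod>v\<leftarrow>us. norm v)" "\<And>us. norm (T us) \<le> L * (\<Prod>v\<leftarrow>us. norm v)"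
  shows "norm (shuffle S T ws) \<le> 2 ^ length ws * (K * L) * (\<Prod>v\<leftarrow>ws. norm v)"
  using assms
proof (induction ws arbitrary: S T K L)
  case Nil
  have "norm (S []) \<le> K" "norm (T []) \<le> L"
    using Nil(1)[of "[]"] Nil(2)[of "[]"] by simp_all
  then have "norm (S []) * norm (T []) \<le> K * L"
    by (intro mult_mono) (auto intro: order_trans[OF norm_ge_zero])
  then show ?case using norm_mult_ineq[of "S []" "T []"] by simp
next
  case (Cons w ws)
  have "norm (shuffle (\<lambda>us. S (w # us)) T ws) \<le> 2 ^ length ws * ((K * norm w) * L) * (\<Prod>v\<leftarrow>ws. norm v)"
    using Cons.prems(1)[of "w # _"] Cons.prems(2) by (intro Cons.IH) (simp_all add: mult.assoc)
  moreover have "norm (shuffle S (\<lambda>us. T (w # us)) ws) \<le> 2 ^ length ws * (K * (L * norm w)) * (\<Prod>v\<leftarrow>ws. norm v)"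
    using Cons.prems(2)[of "w # _"] Cons.prems(1) by (intro Cons.IH) (simp_all add: mult.assoc)
  ultimately show ?case
    using norm_triangle_ineq[of "shuffle (\<lambda>us. S (w # us)) T ws" "shuffle S (\<lambda>us. T (w # us)) ws"]
    by (simp add: mult_ac)
qed

text \<open>
  The number of splittings grows with the length of the list, so the shuffle product has no bound
  that is common to all lengths. Cut down to one length it is a bounded bilinear map, and the product
  rule for bounded bilinear maps applies to it.
\<close>

lift_definition mlin_shuffle ::
  "nat \<Rightarrow> ('a::real_normed_vector, 'b::real_normed_algebra) mlin \<Rightarrow> ('a, 'b) mlin \<Rightarrow> ('a, 'b) mlin"
  is "\<lambda>m S T ws. if length ws = m then shuffle S T ws else 0"
proof -
  fix m and S T :: "'a list \<Rightarrow> 'b"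
  assume S: "bounded_multilinear S" and T: "bounded_multilinear T"
  show "bounded_multilinear (\<lambda>ws. if length ws = m then shuffle S T ws else 0)"
  proof (rule bounded_multilinearI[where K = "2 ^ m * (mlin_norm S * mlin_norm T)"])
    show "linear (\<lambda>v. if length (us @ v # ws) = m then shuffle S T (us @ v # ws) else 0)" for us ws
      using S T by (cases "length us + Suc (length ws) = m")
        (auto simp: bounded_multilinear_def linear_zero intro!: linear_shuffle)
    show "norm (if length ws = m then shuffle S T ws else 0)
        \<le> 2 ^ m * (mlin_norm S * mlin_norm T) * (\<Prod>v\<leftarrow>ws. norm v)" for ws
      using norm_shuffle_le[OF mlin_norm[OF S] mlin_norm[OF T], of ws]
      by (auto intro!: mult_nonneg_nonneg mlin_norm_nonneg S T prod_list_norm_nonneg)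
  qed
qed

lemma bounded_bilinear_mlin_shuffle: "bounded_bilinear (mlin_shuffle m)"
proof
  show "mlin_shuffle m (S + S') T = mlin_shuffle m S T + mlin_shuffle m S' T" for S S' T
    by (rule mlin_eqI) (simp add: mlin_shuffle.rep_eq plus_mlin.rep_eq shuffle_add_left)
  show "mlin_shuffle m S (T + T') = mlin_shuffle m S T + mlin_shuffle m S T'" for S T T'
    by (rule mlin_eqI) (simp add: mlin_shuffle.rep_eq plus_mlin.rep_eq shuffle_add_right)
  show "mlin_shuffle m (c *\<^sub>R S) T = c *\<^sub>R mlin_shuffle m S T" for c S T
    by (rule mlin_eqI) (simp add: mlin_shuffle.rep_eq scaleR_mlin.rep_eq shuffle_scaleR_left)
  show "mlin_shuffle m S (c *\<^sub>R T) = c *\<^sub>R mlin_shuffle m S T" for c S T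
    by (rule mlin_eqI) (simp add: mlin_shuffle.rep_eq scaleR_mlin.rep_eq shuffle_scaleR_right)
  have "norm (mlin_shuffle m S T) \<le> 2 ^ m * (norm S * norm T)" for S T
    unfolding norm_mlin.rep_eq
  proof (rule mlin_norm_le)
    show "norm (mlin_apply (mlin_shuffle m S T) ws)
        \<le> 2 ^ m * (mlin_norm (mlin_apply S) * mlin_norm (mlin_apply T)) * (\<Prod>v\<leftarrow>ws. norm v)" for ws
      using norm_shuffle_le[OF norm_mlin_apply[of S] norm_mlin_apply[of T], of ws]
      by (auto simp: mlin_shuffle.rep_eq simp flip: norm_mlin.rep_eq
          intro!: mult_nonneg_nonneg prod_list_norm_nonneg)
  qed (simp flip: norm_mlin.rep_eq)
  then show "\<exists>K. \<forall>S T. norm (mlin_shuffle m S T) \<le> norm S * norm T * K"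
    by (intro exI[of _ "2 ^ m"] allI) (simp add: mult.commute mult.left_commute)
qed

text \<open>
  The condition in \<open>C_near\<close> for a given neighbourhood, so that several functions can share one.
\<close>

definition C_on ::
  "nat \<Rightarrow> ('a::real_normed_vector \<Rightarrow> 'b::real_normed_vector) \<Rightarrow> 'a set \<Rightarrow> bool" where
  "C_on n f U \<longleftrightarrow> open U \<and> (\<forall>j<n. \<forall>y\<in>U. nth_deriv j f differentiable (at y)) \<and>
     continuous_on U (nth_deriv n f)"

lemma C_near_iff: "C_near n f x \<longleftrightarrow> (\<exists>U. x \<in> U \<and> C_on n f U)"
  unfolding C_near_def C_on_def by blast

lemma C_on_subset: "C_on n f U \<Longrightarrow> open V \<Longrightarrow> V \<subseteq> U \<Longrightarrow> C_on n f V"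
  unfolding C_on_def by (meson continuous_on_subset subsetD)

lemma C_on_differentiable: "C_on n f U \<Longrightarrow> j < n \<Longrightarrow> y \<in> U \<Longrightarrow> nth_deriv j f differentiable (at y)"
  unfolding C_on_def by blast

lemma C_on_continuous:
  assumes "C_on n f U" "j \<le> n"
  shows "continuous_on U (nth_deriv j f)"
proof (cases "j = n")
  case False
  then have "nth_deriv j f differentiable (at y)" if "y \<in> U" for y
    using assms that by (simp add: C_on_differentiable)
  then show ?thesis
    by (auto intro!: continuous_at_imp_continuous_on differentiable_imp_continuous_within)
qed (use assms in \<open>simp add: C_on_def\<close>)

text \<open>
  That \<open>D\<^sup>jf(y)\<close> is a \<open>j\<close>-linear map is not part of its type; it holds because the derivative of a
  function that is constantly 0 is 0. The argument needs all lower derivatives in a whole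
  neighbourhood.
\<close>

lemma nth_deriv_other_length:
  assumes "C_on n f U" "j \<le> n" "y \<in> U" "length ws \<noteq> j"
  shows "mlin_apply (nth_deriv j f y) ws = 0"
  using assms(2-4)
proof (induction j arbitrary: y ws)
  case 0
  then show ?case by (auto simp: mlin_const.rep_eq)
next
  case (Suc j)
  show ?case
  proof (cases ws)
    case Nil
    then show ?thesis using nth_deriv_Suc_Nil by simp
  next
    case (Cons w ws')
    have D: "(nth_deriv j f has_derivative mlin_slice (nth_deriv (Suc j) f y)) (at y)"
      using Suc.prems assms(1) by (intro has_derivative_nth_deriv C_on_differentiable) auto
    have "((\<lambda>y. mlin_apply (nth_deriv j f y) ws') has_derivative
        (\<lambda>w. mlin_apply (mlin_slice (nth_deriv (Suc j) f y) w) ws')) (at y)"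
      by (rule bounded_linear.has_derivative[OF bounded_linear_mlin_apply D])
    moreover have "((\<lambda>y. mlin_apply (nth_deriv j f y) ws') has_derivative (\<lambda>w. 0)) (at y)"
    proof (rule has_derivative_transform_within_open[of "\<lambda>_. 0" "\<lambda>_. 0"])
      show "open U" using assms(1) by (simp add: C_on_def)
      show "0 = mlin_apply (nth_deriv j f z) ws'" if "z \<in> U" for z
        using Suc.IH[of z ws'] Suc.prems that Cons by auto
    qed (use Suc.prems in auto)
    ultimately have "(\<lambda>w. mlin_apply (mlin_slice (nth_deriv (Suc j) f y) w) ws') = (\<lambda>w. 0)"
      by (rule has_derivative_unique)
    then show ?thesis unfolding Cons mlin_slice.rep_eq by metis
  qed
qed

text \<open>
  The derivatives up to order \<open>m\<close> together form one element of the \<open>\<ell>\<^sup>\<infinity>\<close>-sum, because they live on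
  lists of different lengths. With it, the sum over the orders \<open>i + j = m\<close> in the Leibniz formula
  becomes a single shuffle product.
\<close>

definition jet :: "nat \<Rightarrow> ('a::real_normed_vector \<Rightarrow> 'b::real_normed_vector) \<Rightarrow> 'a \<Rightarrow> ('a, 'b) mlin" where
  "jet m f y = (\<Sum>j\<le>m. nth_deriv j f y)"

lemma jet_apply:
  assumes "C_on n f U" "m \<le> n" "y \<in> U" "length ws \<le> m"
  shows "mlin_apply (jet m f y) ws = dir_deriv f y ws"
proof -
  have "mlin_apply (jet m f y) ws = (\<Sum>j\<le>m. if j = length ws then dir_deriv f y ws else 0)"
    unfolding jet_def mlin_apply_sum
    using assms by (intro sum.cong) (auto simp: dir_deriv_def intro!: nth_deriv_other_length)
  then show ?thesis using assms(4) by simp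
qed

lemma continuous_on_jet: "C_on n f U \<Longrightarrow> m \<le> n \<Longrightarrow> continuous_on U (jet m f)"
  unfolding jet_def by (intro continuous_on_sum C_on_continuous[of n]) auto

lemma has_derivative_jet:
  assumes "C_on n f U" "m < n" "y \<in> U"
  shows "(jet m f has_derivative (\<lambda>w. \<Sum>j\<le>m. mlin_slice (nth_deriv (Suc j) f y) w)) (at y)"
  unfolding jet_def using assms
  by (intro has_derivative_sum has_derivative_nth_deriv C_on_differentiable) auto

lemma jet_slice_apply:
  assumes "C_on n f U" "m < n" "y \<in> U" "length ws \<le> m"
  shows "mlin_apply (\<Sum>j\<le>m. mlin_slice (nth_deriv (Suc j) f y) w) ws = dir_deriv f y (w # ws)"
proof -
  have "mlin_apply (\<Sum>j\<le>m. mlin_slice (nth_deriv (Suc j) f y) w) ws =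
      (\<Sum>j\<le>m. if j = length ws then dir_deriv f y (w # ws) else 0)"
    unfolding mlin_apply_sum mlin_slice.rep_eq
    using assms by (intro sum.cong) (auto simp: dir_deriv_def simp del: nth_deriv.simps
        intro!: nth_deriv_other_length)
  then show ?thesis using assms(4) by simp
qed

text \<open>
  The derivative of \<open>jet m f\<close> is \<open>jet (Suc m) f\<close> with its first argument fixed. So the product rule
  for \<open>mlin_shuffle m\<close> gives the two summands of the recursion for \<open>shuffle\<close> on a list of length
  \<open>Suc m\<close>. The formula at order \<open>m\<close> on the whole of \<open>U\<close> is what makes the next derivative exist, which
  is the second claim.
\<close>

lemma nth_deriv_mult:
  fixes f g :: "'a::real_normed_vector \<Rightarrow> 'b::real_normed_algebra"
  assumes f: "C_on n f U" and g: "C_on n g U" and "m \<le> n" "y \<in> U"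
  shows "nth_deriv m (\<lambda>y. f y * g y) y = mlin_shuffle m (jet m f y) (jet m g y)"
    and "m < n \<Longrightarrow> nth_deriv m (\<lambda>y. f y * g y) differentiable (at y)"
proof -
  let ?h = "\<lambda>y. f y * g y"
  have diff: "(nth_deriv m ?h has_derivative (\<lambda>w.
      mlin_shuffle m (jet m f y) (\<Sum>j\<le>m. mlin_slice (nth_deriv (Suc j) g y) w) +
      mlin_shuffle m (\<Sum>j\<le>m. mlin_slice (nth_deriv (Suc j) f y) w) (jet m g y))) (at y)"
    if "\<And>z. z \<in> U \<Longrightarrow> nth_deriv m ?h z = mlin_shuffle m (jet m f z) (jet m g z)" "m < n" "y \<in> U"
    for m y
  proof (rule has_derivative_transform_within_open)
    show "((\<lambda>z. mlin_shuffle m (jet m f z) (jet m g z)) has_derivative (\<lambda>w.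
      mlin_shuffle m (jet m f y) (\<Sum>j\<le>m. mlin_slice (nth_deriv (Suc j) g y) w) +
      mlin_shuffle m (\<Sum>j\<le>m. mlin_slice (nth_deriv (Suc j) f y) w) (jet m g y))) (at y)"
      using that by (intro bounded_bilinear.FDERIV[OF bounded_bilinear_mlin_shuffle]
          has_derivative_jet[OF f] has_derivative_jet[OF g])
    show "open U" using f by (simp add: C_on_def)
  qed (use that in auto)
  have eq: "nth_deriv m ?h y = mlin_shuffle m (jet m f y) (jet m g y)" if "m \<le> n" "y \<in> U" for m y
    using that
  proof (induction m arbitrary: y)
    case 0
    show ?case
      by (rule mlin_eqI) (simp add: jet_def mlin_const.rep_eq mlin_shuffle.rep_eq)
  next
    case (Suc m)
    note D = diff[of m y]
    show ?case
    proof (rule mlin_eqI)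
      fix ws
      show "mlin_apply (nth_deriv (Suc m) ?h y) ws =
          mlin_apply (mlin_shuffle (Suc m) (jet (Suc m) f y) (jet (Suc m) g y)) ws"
      proof (cases ws)
        case Nil
        then show ?thesis using nth_deriv_Suc_Nil[of m ?h y] by (simp add: mlin_shuffle.rep_eq)
      next
        case (Cons w us)
        \<comment> \<open>The sublists have length at most \<open>m\<close>, where jets of order \<open>m\<close> and \<open>Suc m\<close> agree.\<close>
        have "shuffle (mlin_apply (jet m f y))
             (mlin_apply (\<Sum>j\<le>m. mlin_slice (nth_deriv (Suc j) g y) w)) us =
          shuffle (mlin_apply (jet (Suc m) f y)) (\<lambda>us. mlin_apply (jet (Suc m) g y) (w # us)) us"
          if "length us = m"
          using that Suc.prems
          by (intro shuffle_cong) (simp_all add: jet_apply[OF f] jet_apply[OF g] jet_slice_apply[OF g]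
              del: nth_deriv.simps)
        moreover have "shuffle (mlin_apply (\<Sum>j\<le>m. mlin_slice (nth_deriv (Suc j) f y) w))
             (mlin_apply (jet m g y)) us =
          shuffle (\<lambda>us. mlin_apply (jet (Suc m) f y) (w # us)) (mlin_apply (jet (Suc m) g y)) us"
          if "length us = m"
          using that Suc.prems
          by (intro shuffle_cong) (simp_all add: jet_apply[OF f] jet_apply[OF g] jet_slice_apply[OF f]
              del: nth_deriv.simps)
        ultimately show ?thesis
          unfolding Cons using Suc
          by (subst nth_deriv_Suc_Cons[OF D])
            (auto simp: plus_mlin.rep_eq mlin_shuffle.rep_eq simp del: nth_deriv.simps)
      qed
    qed
  qed
  show "nth_deriv m ?h y = mlin_shuffle m (jet m f y) (jet m g y)"
    by (rule eq[OF assms(3,4)])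
  show "nth_deriv m ?h differentiable (at y)" if "m < n"
    using diff[OF eq that assms(4)] that unfolding differentiable_def by auto
qed

lemma C_on_mult:
  fixes f g :: "'a::real_normed_vector \<Rightarrow> 'b::real_normed_algebra"
  assumes f: "C_on n f U" and g: "C_on n g U"
  shows "C_on n (\<lambda>y. f y * g y) U"
  unfolding C_on_def
proof (intro conjI allI impI ballI)
  show "open U" using f by (simp add: C_on_def)
  show "nth_deriv j (\<lambda>y. f y * g y) differentiable (at y)" if "j < n" "y \<in> U" for j y
    using nth_deriv_mult(2)[OF f g] that by simp
  have "continuous_on U (\<lambda>y. mlin_shuffle n (jet n f y) (jet n g y))"
    by (intro bounded_bilinear.continuous_on[OF bounded_bilinear_mlin_shuffle]
        continuous_on_jet[OF f] continuous_on_jet[OF g] order_refl)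
  then show "continuous_on U (nth_deriv n (\<lambda>y. f y * g y))"
    by (rule continuous_on_eq) (simp add: nth_deriv_mult(1)[OF f g])
qed

lemma C_on_pointwise_prod:
  fixes f :: "nat \<Rightarrow> 'a::real_normed_vector \<Rightarrow> 'b::real_normed_algebra"
  assumes "1 \<le> r" "\<And>a. a \<in> {1..r} \<Longrightarrow> C_on n (f a) U"
  shows "C_on n (pointwise_prod f r) U"
  using assms
proof (induction r rule: nat_induct_at_least)
  case base
  then show ?case by (simp add: pointwise_prod_def)
next
  case (Suc r)
  then obtain m where m: "r = Suc m" by (cases r) auto
  have "C_on n (\<lambda>y. pointwise_prod f r y * f (Suc r) y) U"
    using Suc by (intro C_on_mult) auto
  then show ?case by (simp add: pointwise_prod_def m)
qed

section \<open>One differentiation of an ordered product\<close>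

lemma ordered_prod_Suc: "1 \<le> r \<Longrightarrow> ordered_prod g (Suc r) = ordered_prod g r * g (Suc r)"
  by (cases r) auto

lemma ordered_prod_cong:
  assumes "1 \<le> r" "\<And>a. a \<in> {1..r} \<Longrightarrow> g a = h a"
  shows "ordered_prod g r = ordered_prod h r"
  using assms by (induction r rule: nat_induct_at_least) (simp_all add: ordered_prod_Suc)

lemma has_derivative_ordered_prod:
  fixes g :: "'a::real_normed_vector \<Rightarrow> nat \<Rightarrow> 'b::real_normed_algebra"
  assumes "1 \<le> r" "\<And>a. a \<in> {1..r} \<Longrightarrow> ((\<lambda>y. g y a) has_derivative D a) (at y)"
  shows "((\<lambda>y. ordered_prod (g y) r) has_derivative
    (\<lambda>w. \<Sum>b = 1..r. ordered_prod ((g y)(b := D b w)) r)) (at y)"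
  using assms
proof (induction r rule: nat_induct_at_least)
  case base
  then show ?case by simp
next
  case (Suc r)
  have "((\<lambda>y. ordered_prod (g y) r * g y (Suc r)) has_derivative
      (\<lambda>w. ordered_prod (g y) r * D (Suc r) w +
        (\<Sum>b = 1..r. ordered_prod ((g y)(b := D b w)) r) * g y (Suc r))) (at y)"
    by (intro has_derivative_mult Suc.IH) (use Suc.prems in auto)
  moreover have "ordered_prod (g y) r * D (Suc r) w +
        (\<Sum>b = 1..r. ordered_prod ((g y)(b := D b w)) r) * g y (Suc r) =
      (\<Sum>b = 1..Suc r. ordered_prod ((g y)(b := D b w)) (Suc r))" for w
  proof -
    have "ordered_prod ((g y)(Suc r := D (Suc r) w)) r = ordered_prod (g y) r"
      using Suc.hyps by (intro ordered_prod_cong) auto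
    then show ?thesis
      using Suc.hyps by (simp add: ordered_prod_Suc sum_distrib_right)
  qed
  ultimately show ?case by (simp only: ordered_prod_Suc[OF Suc.hyps])
qed

lemma C_on_dir_deriv:
  assumes "C_on n f U" "length ws < n" "y \<in> U"
  shows "((\<lambda>y. dir_deriv f y ws) has_derivative (\<lambda>w. dir_deriv f y (w # ws))) (at y)"
  using assms by (intro dir_deriv_Cons C_on_differentiable)

text \<open>
  The common induction step of the Boolean and of the binomial rule: if a derivative of the product
  is known near \<open>y\<close> as a combination of products of derivatives, then one more direction \<open>w\<close>, put in
  front, is distributed over the factors. The two rules differ only in the combinatorics of the
  index set. As \<open>w\<close> always comes first, lists of directions stay sorted if they are built up from
  the largest index down to the smallest.
\<close>

lemma leibniz_step:
  fixes f :: "nat \<Rightarrow> 'a::real_normed_vector \<Rightarrow> 'b::real_normed_algebra"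
  assumes r: "1 \<le> r" and f: "\<And>a. a \<in> {1..r} \<Longrightarrow> C_on n (f a) U"
    and eq: "\<And>z. z \<in> U \<Longrightarrow> dir_deriv (pointwise_prod f r) z ws =
        (\<Sum>c\<in>C. q c *\<^sub>R ordered_prod (\<lambda>a. dir_deriv (f a) z (L c a)) r)"
    and ws: "length ws < n" and L: "\<And>c a. c \<in> C \<Longrightarrow> a \<in> {1..r} \<Longrightarrow> length (L c a) < n"
    and y: "y \<in> U"
  shows "dir_deriv (pointwise_prod f r) y (w # ws) = (\<Sum>c\<in>C. q c *\<^sub>R
      (\<Sum>b = 1..r. ordered_prod (\<lambda>a. dir_deriv (f a) y (((L c)(b := w # L c b)) a)) r))"
proof -
  have P: "C_on n (pointwise_prod f r) U"
    using r f by (rule C_on_pointwise_prod)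
  have "((\<lambda>z. \<Sum>c\<in>C. q c *\<^sub>R ordered_prod (\<lambda>a. dir_deriv (f a) z (L c a)) r) has_derivative
      (\<lambda>w. \<Sum>c\<in>C. q c *\<^sub>R (\<Sum>b = 1..r. ordered_prod
        ((\<lambda>a. dir_deriv (f a) y (L c a))(b := dir_deriv (f b) y (w # L c b))) r))) (at y)"
    using y L by (intro has_derivative_sum has_derivative_scaleR_right has_derivative_ordered_prod r
        C_on_dir_deriv[OF f])
  moreover have "((\<lambda>z. \<Sum>c\<in>C. q c *\<^sub>R ordered_prod (\<lambda>a. dir_deriv (f a) z (L c a)) r) has_derivative
      (\<lambda>w. dir_deriv (pointwise_prod f r) y (w # ws))) (at y)"
    by (rule has_derivative_transform_within_open[OF C_on_dir_deriv[OF P ws y]])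
      (use P y eq in \<open>auto simp: C_on_def\<close>)
  ultimately have "dir_deriv (pointwise_prod f r) y (w # ws) = (\<Sum>c\<in>C. q c *\<^sub>R
      (\<Sum>b = 1..r. ordered_prod
        ((\<lambda>a. dir_deriv (f a) y (L c a))(b := dir_deriv (f b) y (w # L c b))) r))"
    by (rule fun_cong[OF has_derivative_unique, symmetric])
  also have "\<dots> = (\<Sum>c\<in>C. q c *\<^sub>R
      (\<Sum>b = 1..r. ordered_prod (\<lambda>a. dir_deriv (f a) y (((L c)(b := w # L c b)) a)) r))"
    by (intro sum.cong refl arg_cong2[of _ _ _ _ scaleR] ordered_prod_cong r) auto
  finally show ?thesis .
qed

section \<open>The Boolean product rule\<close>

definition ordered_partitions :: "nat \<Rightarrow> nat set \<Rightarrow> (nat \<Rightarrow> nat set) set" where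
  "ordered_partitions r I =
     {J. J \<in> {1..r} \<rightarrow>\<^sub>E Pow I \<and> disjoint_family_on J {1..r} \<and> (\<Union>a\<in>{1..r}. J a) = I}"

lemma dirs_set_insert_less:
  assumes "finite I" "\<And>j. j \<in> I \<Longrightarrow> i < j"
  shows "dirs_set v (insert i I) = v i # dirs_set v I"
proof -
  have "insort i (sorted_list_of_set I) = i # sorted_list_of_set I"
    using assms by (intro insort_is_Cons) (auto intro: less_imp_le)
  moreover have "i \<notin> I" using assms(2) by blast
  ultimately show ?thesis
    using assms(1) by (simp add: dirs_set_def)
qed

text \<open>
  An ordered partition of \<open>I \<union> {i}\<close> is an ordered partition of \<open>I\<close> together with the choice of the
  block that receives \<open>i\<close>.
\<close>

lemma sum_ordered_partitions_insert:
  assumes "i \<notin> I"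
  shows "(\<Sum>J\<in>ordered_partitions r I. \<Sum>b = 1..r. h (J(b := insert i (J b)))) =
    (\<Sum>J\<in>ordered_partitions r (insert i I). h J)"
proof -
  let ?del = "\<lambda>J. \<lambda>a\<in>{1..r}. J a - {i}" and ?ins = "\<lambda>J b. J(b := insert i (J b))"
  \<comment> \<open>The block that contains \<open>i\<close>, unique because the blocks are disjoint.\<close>
  let ?block = "\<lambda>J. THE b. b \<in> {1..r} \<and> i \<in> J b"
  have block: "?block J = b"
    if J: "J \<in> ordered_partitions r K" and b: "b \<in> {1..r}" "i \<in> J b" for J b K
  proof (rule the_equality)
    show "c = b" if "c \<in> {1..r} \<and> i \<in> J c" for c
      using J b that unfolding ordered_partitions_def disjoint_family_on_def by blast
  qed (use b in simp)
  have ins: "?ins J b \<in> ordered_partitions r (insert i I)"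
    if "J \<in> ordered_partitions r I" "b \<in> {1..r}" for J b
    using that assms unfolding ordered_partitions_def disjoint_family_on_def
    by (auto simp: PiE_iff extensional_def split: if_splits)
  have del: "?del J \<in> ordered_partitions r I" if "J \<in> ordered_partitions r (insert i I)" for J
  proof -
    have "disjoint_family_on (?del J) {1..r}"
      unfolding disjoint_family_on_def
    proof (intro ballI impI)
      fix a b assume ab: "a \<in> {1..r}" "b \<in> {1..r}" "a \<noteq> b"
      then have "J a \<inter> J b = {}"
        using that unfolding ordered_partitions_def disjoint_family_on_def by blast
      with ab show "?del J a \<inter> ?del J b = {}" by auto
    qed
    moreover have "(\<Union>a\<in>{1..r}. ?del J a) = (\<Union>a\<in>{1..r}. J a) - {i}" by auto
    ultimately show ?thesis
      using that assms unfolding ordered_partitions_def by (auto simp: PiE_iff)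
  qed
  have ins_del: "?ins (?del J) b = J"
    if J: "J \<in> ordered_partitions r (insert i I)" and b: "b \<in> {1..r}" "i \<in> J b" for J b
  proof
    fix a
    have "i \<notin> J a" if "a \<in> {1..r}" "a \<noteq> b"
      using J b that unfolding ordered_partitions_def disjoint_family_on_def by blast
    moreover have "J a = undefined" if "a \<notin> {1..r}"
      using J that by (auto simp: ordered_partitions_def)
    ultimately show "?ins (?del J) b a = J a"
      using b by (cases "a = b"; cases "a \<in> {1..r}") auto
  qed
  have del_ins: "?del (?ins J b) = J" if "J \<in> ordered_partitions r I" "b \<in> {1..r}" for J b
  proof
    fix a
    have "i \<notin> J a" if "a \<in> {1..r}"
      using \<open>J \<in> _\<close> assms that by (auto simp: ordered_partitions_def)
    moreover have "J a = undefined" if "a \<notin> {1..r}"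
      using \<open>J \<in> _\<close> that by (auto simp: ordered_partitions_def)
    ultimately show "?del (?ins J b) a = J a"
      using \<open>b \<in> _\<close> by (cases "a = b"; cases "a \<in> {1..r}") auto
  qed
  have "(\<Sum>J\<in>ordered_partitions r I. \<Sum>b = 1..r. h (?ins J b)) =
      (\<Sum>(J, b)\<in>ordered_partitions r I \<times> {1..r}. h (?ins J b))"
    by (simp add: sum.cartesian_product)
  also have "\<dots> = (\<Sum>J\<in>ordered_partitions r (insert i I). h J)"
  proof (rule sum.reindex_bij_witness[of _ "\<lambda>J. (?del J, ?block J)" "\<lambda>(J, b). ?ins J b"])
    fix J assume J: "J \<in> ordered_partitions r (insert i I)"
    then have "i \<in> (\<Union>a\<in>{1..r}. J a)" unfolding ordered_partitions_def by blast
    then obtain b where b: "b \<in> {1..r}" "i \<in> J b" by blast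
    show "(\<lambda>(J, b). ?ins J b) (?del J, ?block J) = J"
      using ins_del[OF J b] by (simp only: block[OF J b] prod.case)
    show "(?del J, ?block J) \<in> ordered_partitions r I \<times> {1..r}"
      using del[OF J] b(1) by (simp only: block[OF J b] mem_Times_iff fst_conv snd_conv simp_thms)
  next
    fix p assume p: "p \<in> ordered_partitions r I \<times> {1..r}"
    then obtain J b where [simp]: "p = (J, b)" and J: "J \<in> ordered_partitions r I" and b: "b \<in> {1..r}"
      by auto
    have "?block (?ins J b) = b" using ins[OF J b] b by (rule block) simp
    then show "(?del ((\<lambda>(J, b). ?ins J b) p), ?block ((\<lambda>(J, b). ?ins J b) p)) = p"
      using del_ins[OF J b] by simp
    show "(\<lambda>(J, b). ?ins J b) p \<in> ordered_partitions r (insert i I)"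
      using ins[OF J b] by simp
  qed auto
  finally show ?thesis .
qed

text \<open>
  Induction on \<open>I\<close>, adding an element smaller than all others, so that the new direction is the
  first one of each list in which it occurs.
\<close>

lemma boolean_product_rule:
  fixes f :: "nat \<Rightarrow> 'a::real_normed_vector \<Rightarrow> 'b::real_normed_algebra"
  assumes r: "1 \<le> r" and f: "\<And>a. a \<in> {1..r} \<Longrightarrow> C_on n (f a) U"
    and "finite I" "card I \<le> n" "y \<in> U"
  shows "dir_deriv (pointwise_prod f r) y (dirs_set v I) =
    (\<Sum>J\<in>ordered_partitions r I. ordered_prod (\<lambda>a. dir_deriv (f a) y (dirs_set v (J a))) r)"
  using assms(3-5)
proof (induction I arbitrary: y rule: finite_linorder_min_induct)
  case empty
  have "ordered_partitions r {} = {\<lambda>a\<in>{1..r}. {}}"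
    unfolding ordered_partitions_def disjoint_family_on_def
    by (auto simp: PiE_iff extensional_def fun_eq_iff)
  moreover have "ordered_prod (\<lambda>a. dir_deriv (f a) y (dirs_set v ((\<lambda>a\<in>{1..r}. {}) a))) r =
      ordered_prod (\<lambda>a. f a y) r"
    using r by (intro ordered_prod_cong) (auto simp: dirs_set_def dir_deriv_Nil)
  ultimately show ?case
    by (simp add: dirs_set_def dir_deriv_Nil pointwise_prod_def)
next
  case (insert i I)
  have i: "i \<notin> I" using insert.hyps by blast
  have card: "card I < n" using insert i by simp
  have len: "length (dirs_set v K) = card K" if "K \<subseteq> insert i I" for K
    using that by (simp add: dirs_set_def)
  have "dir_deriv (pointwise_prod f r) y (v i # dirs_set v I) =
      (\<Sum>J\<in>ordered_partitions r I. 1 *\<^sub>R (\<Sum>b = 1..r. ordered_prod (\<lambda>a. dir_deriv (f a) y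
        (((\<lambda>a. dirs_set v (J a))(b := v i # dirs_set v (J b))) a)) r))"
  proof (rule leibniz_step[OF r f])
    show "length (dirs_set v I) < n" using len[OF subset_insertI] card by simp
    show "length (dirs_set v (J a)) < n" if "J \<in> ordered_partitions r I" "a \<in> {1..r}" for J a
    proof -
      have "J a \<subseteq> I" using that by (auto simp: ordered_partitions_def)
      then show ?thesis using len[OF subset_trans[OF _ subset_insertI], of "J a"] card card_mono[OF insert.hyps(1), of "J a"] by auto
    qed
  qed (use insert card in auto)
  also have "\<dots> = (\<Sum>J\<in>ordered_partitions r I. \<Sum>b = 1..r. ordered_prod (\<lambda>a. dir_deriv (f a) y
        (dirs_set v ((J(b := insert i (J b))) a))) r)"
  proof (intro sum.cong refl, subst scaleR_one, intro sum.cong refl ordered_prod_cong r)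
    fix J b a assume J: "J \<in> ordered_partitions r I" and a: "a \<in> {1..r}" and b: "b \<in> {1..r}"
    have "J b \<subseteq> I" using J b by (auto simp: ordered_partitions_def)
    then have "dirs_set v (insert i (J b)) = v i # dirs_set v (J b)"
      using insert.hyps by (intro dirs_set_insert_less) (auto intro: finite_subset)
    then show "dir_deriv (f a) y (((\<lambda>a. dirs_set v (J a))(b := v i # dirs_set v (J b))) a) =
        dir_deriv (f a) y (dirs_set v ((J(b := insert i (J b))) a))"
      by simp
  qed
  also have "\<dots> = (\<Sum>J\<in>ordered_partitions r (insert i I).
      ordered_prod (\<lambda>a. dir_deriv (f a) y (dirs_set v (J a))) r)"
    by (rule sum_ordered_partitions_insert[OF i])
  finally show ?case
    using insert.hyps by (simp add: dirs_set_insert_less)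
qed

section \<open>The binomial product rule\<close>

lemma multi_indices_iff:
  "\<alpha> \<in> multi_indices k \<longleftrightarrow> (\<forall>i. i \<notin> {1..k} \<longrightarrow> Poly_Mapping.lookup \<alpha> i = 0)"
  by (auto simp: multi_indices_def in_keys_iff)

lemma multi_indices_add_single:
  "\<beta> \<in> multi_indices k \<Longrightarrow> i \<in> {1..k} \<Longrightarrow> Poly_Mapping.single i m + \<beta> \<in> multi_indices k"
  by (auto simp: multi_indices_iff lookup_add lookup_single when_def)

lemma mi_size_add: "mi_size k (\<alpha> + \<beta>) = mi_size k \<alpha> + mi_size k \<beta>"
  by (simp add: mi_size_def lookup_add sum.distrib)

lemma mi_size_sum: "mi_size k (\<Sum>a\<in>S. \<alpha> a) = (\<Sum>a\<in>S. mi_size k (\<alpha> a))"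
  by (induction S rule: infinite_finite_induct) (simp_all add: mi_size_add, simp_all add: mi_size_def)

lemma mi_size_single: "i \<in> {1..k} \<Longrightarrow> mi_size k (Poly_Mapping.single i m) = m"
  by (simp add: mi_size_def lookup_single when_def)

lemma length_mi_list: "length (mi_list k \<alpha>) = mi_size k \<alpha>"
proof -
  have "length (mi_list k \<alpha>) = (\<Sum>i\<leftarrow>[1..<Suc k]. Poly_Mapping.lookup \<alpha> i)"
    unfolding mi_list_def by (simp add: length_concat comp_def del: upt_Suc)
  also have "\<dots> = mi_size k \<alpha>"
    unfolding mi_size_def by (subst sum_list_distinct_conv_sum_set)
      (simp_all add: atLeastLessThanSuc_atLeastAtMost del: upt_Suc)
  finally show ?thesis .
qed

lemma length_dirs_rep: "length (dirs_rep k v \<alpha>) = mi_size k \<alpha>"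
  by (simp add: dirs_rep_def length_mi_list)

lemma finite_multi_indices_le: "finite {\<alpha> \<in> multi_indices k. mi_size k \<alpha> \<le> m}"
proof (rule finite_imageD)
  show "finite ((\<lambda>\<alpha>. restrict (Poly_Mapping.lookup \<alpha>) {1..k}) ` {\<alpha> \<in> multi_indices k. mi_size k \<alpha> \<le> m})"
  proof (rule finite_subset)
    show "(\<lambda>\<alpha>. restrict (Poly_Mapping.lookup \<alpha>) {1..k}) ` {\<alpha> \<in> multi_indices k. mi_size k \<alpha> \<le> m}
        \<subseteq> {1..k} \<rightarrow>\<^sub>E {..m}"
    proof (clarsimp simp: mi_size_def)
      fix \<alpha> :: "nat \<Rightarrow>\<^sub>0 nat" and i
      assume "(\<Sum>i = Suc 0..k. Poly_Mapping.lookup \<alpha> i) \<le> m" "Suc 0 \<le> i" "i \<le> k"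
      then show "Poly_Mapping.lookup \<alpha> i \<le> m"
        using member_le_sum[of i "{Suc 0..k}" "Poly_Mapping.lookup \<alpha>"] by simp
    qed
  qed (simp add: finite_PiE)
  show "inj_on (\<lambda>\<alpha>. restrict (Poly_Mapping.lookup \<alpha>) {1..k}) {\<alpha> \<in> multi_indices k. mi_size k \<alpha> \<le> m}"
  proof (rule inj_onI, rule poly_mapping_eqI)
    fix \<alpha> \<beta> :: "nat \<Rightarrow>\<^sub>0 nat" and i
    assume *: "\<alpha> \<in> {\<alpha> \<in> multi_indices k. mi_size k \<alpha> \<le> m}" "\<beta> \<in> {\<alpha> \<in> multi_indices k. mi_size k \<alpha> \<le> m}"
      "restrict (Poly_Mapping.lookup \<alpha>) {1..k} = restrict (Poly_Mapping.lookup \<beta>) {1..k}"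
    show "Poly_Mapping.lookup \<alpha> i = Poly_Mapping.lookup \<beta> i"
      using *(1,2) fun_cong[OF *(3), of i] by (cases "i \<in> {1..k}") (auto simp: multi_indices_iff)
  qed
qed

lemma mi_list_add_single:
  assumes i: "i \<in> {1..k}" and min: "\<And>j. j < i \<Longrightarrow> Poly_Mapping.lookup \<beta> j = 0"
  shows "mi_list k (Poly_Mapping.single i 1 + \<beta>) = i # mi_list k \<beta>"
proof -
  let ?\<alpha> = "Poly_Mapping.single i 1 + \<beta>"
  have split: "[1..<Suc k] = [1..<i] @ i # [Suc i..<Suc k]"
    using i upt_add_eq_append[of 1 i "Suc k - i"] by (simp add: upt_conv_Cons del: upt_Suc)
  have nil: "concat (map (\<lambda>j. replicate (Poly_Mapping.lookup \<alpha> j) j) [1..<i]) = []"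
    if "\<And>j. j < i \<Longrightarrow> Poly_Mapping.lookup \<alpha> j = 0" for \<alpha> :: "nat \<Rightarrow>\<^sub>0 nat"
    using that by (simp add: concat_eq_Nil_conv)
  have min': "Poly_Mapping.lookup ?\<alpha> j = 0" if "j < i" for j
    using min[OF that] that by (simp add: lookup_add lookup_single)
  have mid: "Poly_Mapping.lookup ?\<alpha> i = Suc (Poly_Mapping.lookup \<beta> i)"
    by (simp add: lookup_add)
  have tail: "map (\<lambda>j. replicate (Poly_Mapping.lookup ?\<alpha> j) j) [Suc i..<Suc k]
      = map (\<lambda>j. replicate (Poly_Mapping.lookup \<beta> j) j) [Suc i..<Suc k]"
    by (intro map_cong) (auto simp: lookup_add lookup_single simp del: upt_Suc)
  have "concat (map (\<lambda>j. replicate (Poly_Mapping.lookup ?\<alpha> j) j) [1..<i]) = []"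
    by (rule nil) (rule min')
  moreover have "concat (map (\<lambda>j. replicate (Poly_Mapping.lookup \<beta> j) j) [1..<i]) = []"
    by (rule nil) (rule min)
  ultimately show ?thesis
    unfolding mi_list_def split map_append concat_append list.map concat.simps tail mid
    by (simp only: append_Nil replicate_Suc append_Cons)
qed

lemma mi_fact_pos: "mi_fact k \<alpha> > 0"
  by (simp add: mi_fact_def prod_pos)

lemma mi_fact_add_single:
  assumes "i \<in> {1..k}"
  shows "mi_fact k (Poly_Mapping.single i 1 + \<beta>) =
    real (Suc (Poly_Mapping.lookup \<beta> i)) * mi_fact k \<beta>"
proof -
  have "mi_fact k (Poly_Mapping.single i 1 + \<beta>) =
      (\<Prod>j = 1..k. (if j = i then real (Suc (Poly_Mapping.lookup \<beta> i)) else 1) *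
        fact (Poly_Mapping.lookup \<beta> j))"
    unfolding mi_fact_def by (intro prod.cong) (auto simp: lookup_add lookup_single)
  then show ?thesis
    using assms by (simp add: prod.distrib mi_fact_def)
qed

definition decompositions :: "nat \<Rightarrow> nat \<Rightarrow> (nat \<Rightarrow>\<^sub>0 nat) \<Rightarrow> (nat \<Rightarrow> (nat \<Rightarrow>\<^sub>0 nat)) set" where
  "decompositions r k \<gamma> = {\<alpha>. \<alpha> \<in> {1..r} \<rightarrow>\<^sub>E multi_indices k \<and> (\<Sum>a = 1..r. \<alpha> a) = \<gamma>}"

lemma mi_size_decomposition_le:
  assumes "\<alpha> \<in> decompositions r k \<gamma>" "a \<in> {1..r}"
  shows "mi_size k (\<alpha> a) \<le> mi_size k \<gamma>"
  using member_le_sum[of a "{1..r}" "\<lambda>a. mi_size k (\<alpha> a)"] assms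
  by (auto simp: decompositions_def simp flip: mi_size_sum)

lemma lookup_decomposition:
  assumes "\<alpha> \<in> decompositions r k \<gamma>"
  shows "(\<Sum>a = 1..r. Poly_Mapping.lookup (\<alpha> a) i) = Poly_Mapping.lookup \<gamma> i"
  using assms by (auto simp: decompositions_def lookup_sum)

lemma finite_decompositions: "finite (decompositions r k \<gamma>)"
proof (rule finite_subset)
  show "decompositions r k \<gamma> \<subseteq> {1..r} \<rightarrow>\<^sub>E {\<alpha> \<in> multi_indices k. mi_size k \<alpha> \<le> mi_size k \<gamma>}"
  proof
    fix \<alpha> assume "\<alpha> \<in> decompositions r k \<gamma>"
    then show "\<alpha> \<in> {1..r} \<rightarrow>\<^sub>E {\<alpha> \<in> multi_indices k. mi_size k \<alpha> \<le> mi_size k \<gamma>}"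
      using mi_size_decomposition_le[of \<alpha> r k \<gamma>] unfolding decompositions_def PiE_iff by blast
  qed
qed (intro finite_PiE finite_multi_indices_le finite_atLeastAtMost)

lemma sum_fun_upd_add:
  fixes \<alpha> :: "'i \<Rightarrow> 'm::comm_monoid_add"
  assumes "finite S" "b \<in> S"
  shows "(\<Sum>a\<in>S. (\<alpha>(b := e + \<alpha> b)) a) = e + (\<Sum>a\<in>S. \<alpha> a)"
proof -
  have "(\<Sum>a\<in>S. (\<alpha>(b := e + \<alpha> b)) a) = (\<Sum>a\<in>S. (if a = b then e else 0) + \<alpha> a)"
    by (intro sum.cong) auto
  then show ?thesis using assms by (simp add: sum.distrib)
qed

lemma prod_fun_upd_mult:
  fixes h :: "'m \<Rightarrow> real"
  assumes "finite S" "b \<in> S" "h e = c * h (\<alpha> b)"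
  shows "(\<Prod>a\<in>S. h ((\<alpha>(b := e)) a)) = c * (\<Prod>a\<in>S. h (\<alpha> a))"
proof -
  have "(\<Prod>a\<in>S. h ((\<alpha>(b := e)) a)) = (\<Prod>a\<in>S. (if a = b then c else 1) * h (\<alpha> a))"
    using assms by (intro prod.cong) auto
  then show ?thesis using assms by (simp add: prod.distrib)
qed

lemma decompositions_add_single:
  assumes "i \<in> {1..k}" "b \<in> {1..r}" "\<alpha> \<in> decompositions r k \<gamma>"
  shows "\<alpha>(b := Poly_Mapping.single i 1 + \<alpha> b) \<in> decompositions r k (Poly_Mapping.single i 1 + \<gamma>)"
proof -
  have "(\<Sum>a = 1..r. (\<alpha>(b := Poly_Mapping.single i 1 + \<alpha> b)) a) = Poly_Mapping.single i 1 + \<gamma>"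
    using assms by (subst sum_fun_upd_add) (auto simp: decompositions_def)
  moreover have "\<alpha>(b := Poly_Mapping.single i 1 + \<alpha> b) \<in> {1..r} \<rightarrow>\<^sub>E multi_indices k"
    using assms multi_indices_add_single[of _ k i 1]
    by (auto simp: decompositions_def PiE_iff extensional_def)
  ultimately show ?thesis by (simp only: decompositions_def mem_Collect_eq simp_thms)
qed

text \<open>
  Subtraction of multi-indices is truncated, so it undoes the addition of the unit multi-index only
  where the entry is positive.
\<close>

lemma decompositions_remove_single:
  assumes i: "i \<in> {1..k}" and b: "b \<in> {1..r}" "Poly_Mapping.lookup (\<alpha> b) i > 0"
    and \<alpha>: "\<alpha> \<in> decompositions r k (Poly_Mapping.single i 1 + \<gamma>)"
  shows "\<alpha>(b := \<alpha> b - Poly_Mapping.single i 1) \<in> decompositions r k \<gamma>" (is "?\<alpha>' \<in> _")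
    and "Poly_Mapping.single i 1 + (\<alpha> b - Poly_Mapping.single i 1) = \<alpha> b"
proof -
  show eq: "Poly_Mapping.single i 1 + (\<alpha> b - Poly_Mapping.single i 1) = \<alpha> b"
    using b(2) by (intro poly_mapping_eqI) (auto simp: lookup_add lookup_minus lookup_single when_def)
  then have upd: "?\<alpha>'(b := Poly_Mapping.single i 1 + ?\<alpha>' b) = \<alpha>"
    by simp
  have "Poly_Mapping.single i 1 + (\<Sum>a = 1..r. ?\<alpha>' a) = Poly_Mapping.single i 1 + \<gamma>"
    using sum_fun_upd_add[of "{1..r}" b ?\<alpha>' "Poly_Mapping.single i 1"] \<alpha> b(1)
    unfolding upd by (simp add: decompositions_def)
  then have "(\<Sum>a = 1..r. ?\<alpha>' a) = \<gamma>"
    by (rule add_left_imp_eq)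
  moreover have "?\<alpha>' \<in> {1..r} \<rightarrow>\<^sub>E multi_indices k"
    using \<alpha> b by (auto simp: decompositions_def PiE_iff extensional_def multi_indices_iff lookup_minus)
  ultimately show "?\<alpha>' \<in> decompositions r k \<gamma>"
    by (simp only: decompositions_def mem_Collect_eq simp_thms)
qed

abbreviation multinomial :: "nat \<Rightarrow> nat \<Rightarrow> (nat \<Rightarrow>\<^sub>0 nat) \<Rightarrow> (nat \<Rightarrow> (nat \<Rightarrow>\<^sub>0 nat)) \<Rightarrow> real" where
  "multinomial r k \<gamma> \<alpha> \<equiv> mi_fact k \<gamma> / (\<Prod>a = 1..r. mi_fact k (\<alpha> a))"

lemma multinomial_add_single:
  assumes i: "i \<in> {1..k}" and b: "b \<in> {1..r}"
  shows "multinomial r k (Poly_Mapping.single i 1 + \<gamma>) (\<alpha>(b := Poly_Mapping.single i 1 + \<alpha> b)) *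
      (Suc (Poly_Mapping.lookup (\<alpha> b) i) / Suc (Poly_Mapping.lookup \<gamma> i)) = multinomial r k \<gamma> \<alpha>"
proof -
  have "(\<Prod>a = 1..r. mi_fact k ((\<alpha>(b := Poly_Mapping.single i 1 + \<alpha> b)) a)) =
      Suc (Poly_Mapping.lookup (\<alpha> b) i) * (\<Prod>a = 1..r. mi_fact k (\<alpha> a))"
    using b by (intro prod_fun_upd_mult mi_fact_add_single i) auto
  moreover have "t * F / (s * D) * (s / t) = F / D" if "s > 0" "t > 0" for s t F D :: real
    using that by simp
  ultimately show ?thesis
    unfolding mi_fact_add_single[OF i] by (simp del: fun_upd_apply of_nat_Suc)
qed

text \<open>
  The multinomial form of Pascal's rule. Let \<open>e\<close> be the unit multi-index at \<open>i\<close>. A decomposition \<open>\<alpha>\<close>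
  of \<open>e + \<gamma>\<close> arises from one of \<open>\<gamma>\<close> by adding \<open>e\<close> to the part \<open>\<alpha>\<^sub>b\<close>, for each \<open>b\<close> whose \<open>i\<close>-th entry
  \<open>\<alpha>\<^sub>b(i)\<close> is positive. Relative to the multinomial coefficient of \<open>\<alpha>\<close>, the choice of \<open>b\<close> has
  weight \<open>\<alpha>\<^sub>b(i) / (\<gamma>(i) + 1)\<close>, and these weights add up to 1 because \<open>\<Sum>\<^sub>b \<alpha>\<^sub>b(i) = \<gamma>(i) + 1\<close>.
\<close>

lemma sum_decompositions_add_single:
  fixes h :: "(nat \<Rightarrow> (nat \<Rightarrow>\<^sub>0 nat)) \<Rightarrow> 'b::real_vector"
  assumes i: "i \<in> {1..k}"
  shows "(\<Sum>\<alpha>\<in>decompositions r k \<gamma>. multinomial r k \<gamma> \<alpha> *\<^sub>R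
      (\<Sum>b = 1..r. h (\<alpha>(b := Poly_Mapping.single i 1 + \<alpha> b)))) =
    (\<Sum>\<alpha>\<in>decompositions r k (Poly_Mapping.single i 1 + \<gamma>).
      multinomial r k (Poly_Mapping.single i 1 + \<gamma>) \<alpha> *\<^sub>R h \<alpha>)"
proof -
  let ?e = "Poly_Mapping.single i 1 :: nat \<Rightarrow>\<^sub>0 nat"
  let ?ins = "\<lambda>\<alpha> b. \<alpha>(b := ?e + \<alpha> b)" and ?del = "\<lambda>\<alpha> b. \<alpha>(b := \<alpha> b - ?e)"
  let ?S = "decompositions r k \<gamma> \<times> {1..r}" and ?T = "decompositions r k (?e + \<gamma>) \<times> {1..r}"
  let ?w = "\<lambda>\<alpha> b. multinomial r k (?e + \<gamma>) \<alpha> *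
    (Poly_Mapping.lookup (\<alpha> b) i / Suc (Poly_Mapping.lookup \<gamma> i))"
  \<comment> \<open>Pairs that do not arise by adding \<open>?e\<close> to a part; their weight is 0.\<close>
  let ?Z = "{(\<alpha>, b) \<in> ?T. Poly_Mapping.lookup (\<alpha> b) i = 0}"
  have "(\<Sum>\<alpha>\<in>decompositions r k \<gamma>. multinomial r k \<gamma> \<alpha> *\<^sub>R (\<Sum>b = 1..r. h (?ins \<alpha> b))) =
      (\<Sum>(\<alpha>, b)\<in>?S. multinomial r k \<gamma> \<alpha> *\<^sub>R h (?ins \<alpha> b))"
    by (simp add: scaleR_sum_right sum.cartesian_product)
  also have "\<dots> = (\<Sum>(\<alpha>, b)\<in>?T. ?w \<alpha> b *\<^sub>R h \<alpha>)"
  proof (rule sum.reindex_bij_witness_not_neutral[of "{}" ?Z _ "\<lambda>(\<alpha>, b). (?del \<alpha> b, b)" "\<lambda>(\<alpha>, b). (?ins \<alpha> b, b)"])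
    show "finite ?Z"
      by (rule finite_subset[of _ ?T]) (auto simp: finite_decompositions)
    fix p assume "p \<in> ?S - {}"
    then obtain \<alpha> b where p: "p = (\<alpha>, b)" and \<alpha>: "\<alpha> \<in> decompositions r k \<gamma>" and b: "b \<in> {1..r}"
      by auto
    show "(case case p of (\<alpha>, b) \<Rightarrow> (?ins \<alpha> b, b) of (\<alpha>, b) \<Rightarrow> (?del \<alpha> b, b)) = p"
      by (simp add: p)
    show "(case p of (\<alpha>, b) \<Rightarrow> (?ins \<alpha> b, b)) \<in> ?T - ?Z"
      using decompositions_add_single[OF i b \<alpha>] b by (simp add: p lookup_add)
  next
    fix p assume "p \<in> ?S"
    then obtain \<alpha> b where p: "p = (\<alpha>, b)" and b: "b \<in> {1..r}"
      by auto
    have "?w (?ins \<alpha> b) b = multinomial r k \<gamma> \<alpha>"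
      using multinomial_add_single[OF i b, of \<gamma> \<alpha>] by (simp add: lookup_add)
    then show "(case case p of (\<alpha>, b) \<Rightarrow> (?ins \<alpha> b, b) of (\<alpha>, b) \<Rightarrow> ?w \<alpha> b *\<^sub>R h \<alpha>) =
        (case p of (\<alpha>, b) \<Rightarrow> multinomial r k \<gamma> \<alpha> *\<^sub>R h (?ins \<alpha> b))"
      by (simp only: p prod.case)
  next
    fix q assume "q \<in> ?T - ?Z"
    then obtain \<alpha> b where q: "q = (\<alpha>, b)" and \<alpha>: "\<alpha> \<in> decompositions r k (?e + \<gamma>)"
      and b: "b \<in> {1..r}" "Poly_Mapping.lookup (\<alpha> b) i > 0"
      by (cases q) auto
    note * = decompositions_remove_single[of i k b r \<alpha> \<gamma>, OF i b \<alpha>]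
    show "(case case q of (\<alpha>, b) \<Rightarrow> (?del \<alpha> b, b) of (\<alpha>, b) \<Rightarrow> (?ins \<alpha> b, b)) = q"
      using *(2) by (simp add: q)
    show "(case q of (\<alpha>, b) \<Rightarrow> (?del \<alpha> b, b)) \<in> ?S - {}"
      using *(1) b by (simp add: q)
  qed auto
  also have "\<dots> = (\<Sum>\<alpha>\<in>decompositions r k (?e + \<gamma>). (\<Sum>b = 1..r. ?w \<alpha> b) *\<^sub>R h \<alpha>)"
    by (simp add: scaleR_sum_left sum.cartesian_product)
  also have "\<dots> = (\<Sum>\<alpha>\<in>decompositions r k (?e + \<gamma>). multinomial r k (?e + \<gamma>) \<alpha> *\<^sub>R h \<alpha>)"
  proof (intro sum.cong refl arg_cong2[of _ _ _ _ scaleR])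
    fix \<alpha> assume "\<alpha> \<in> decompositions r k (?e + \<gamma>)"
    then have "(\<Sum>b = 1..r. Poly_Mapping.lookup (\<alpha> b) i) = Suc (Poly_Mapping.lookup \<gamma> i)"
      using lookup_decomposition[of \<alpha> r k "?e + \<gamma>" i] by (simp add: lookup_add)
    then have "(\<Sum>b = 1..r. real (Poly_Mapping.lookup (\<alpha> b) i)) = real (Suc (Poly_Mapping.lookup \<gamma> i))"
      by (metis of_nat_sum)
    then show "(\<Sum>b = 1..r. ?w \<alpha> b) = multinomial r k (?e + \<gamma>) \<alpha>"
      unfolding sum_distrib_left[symmetric] sum_divide_distrib[symmetric] by (simp del: of_nat_Suc)
  qed
  finally show ?thesis .
qed

text \<open>
  Every multi-index is built from 0 by adding unit multi-indices, each at an index that is at most as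
  large as those added before. On sorted lists this means putting one index in front at a time.
\<close>

lemma multi_index_induct [consumes 1, case_names zero add_single]:
  assumes "\<gamma> \<in> multi_indices k"
    and zero: "P 0"
    and step: "\<And>i \<gamma>. i \<in> {1..k} \<Longrightarrow> \<gamma> \<in> multi_indices k \<Longrightarrow>
      (\<And>j. j < i \<Longrightarrow> Poly_Mapping.lookup \<gamma> j = 0) \<Longrightarrow> P \<gamma> \<Longrightarrow> P (Poly_Mapping.single i 1 + \<gamma>)"
  shows "P \<gamma>"
  using assms(1)
proof (induction "mi_size k \<gamma>" arbitrary: \<gamma>)
  case 0
  have "\<gamma> = 0"
  proof (rule poly_mapping_eqI)
    show "Poly_Mapping.lookup \<gamma> i = Poly_Mapping.lookup 0 i" for i
      using 0 by (cases "i \<in> {1..k}") (auto simp: mi_size_def multi_indices_iff)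
  qed
  then show ?case using zero by simp
next
  case (Suc m)
  define i where "i = (LEAST i. Poly_Mapping.lookup \<gamma> i \<noteq> 0)"
  obtain j where "Poly_Mapping.lookup \<gamma> j \<noteq> 0"
    using Suc.hyps(2) unfolding mi_size_def by (metis Zero_not_Suc sum.neutral)
  then have i: "Poly_Mapping.lookup \<gamma> i \<noteq> 0"
    unfolding i_def by (rule LeastI)
  then have ik: "i \<in> {1..k}"
    using Suc.prems by (auto simp: multi_indices_iff)
  define \<gamma>' where "\<gamma>' = \<gamma> - Poly_Mapping.single i 1"
  have \<gamma>: "\<gamma> = Poly_Mapping.single i 1 + \<gamma>'"
    unfolding \<gamma>'_def using i
    by (intro poly_mapping_eqI) (auto simp: lookup_add lookup_minus lookup_single when_def)
  have "\<gamma>' \<in> multi_indices k"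
    using Suc.prems by (auto simp: \<gamma>'_def multi_indices_iff lookup_minus)
  moreover have "Poly_Mapping.lookup \<gamma>' j = 0" if "j < i" for j
    using not_less_Least[OF that[unfolded i_def]] by (simp add: \<gamma>'_def lookup_minus)
  moreover have "m = mi_size k \<gamma>'"
    using Suc.hyps(2) unfolding \<gamma> mi_size_add mi_size_single[OF ik] by simp
  ultimately show ?case
    unfolding \<gamma> using Suc.hyps(1) ik by (intro step) auto
qed

lemma binomial_product_rule:
  fixes f :: "nat \<Rightarrow> 'a::real_normed_vector \<Rightarrow> 'b::real_normed_algebra"
  assumes r: "1 \<le> r" and f: "\<And>a. a \<in> {1..r} \<Longrightarrow> C_on n (f a) U"
    and \<gamma>: "\<gamma> \<in> multi_indices k" and "mi_size k \<gamma> \<le> n" "y \<in> U"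
  shows "dir_deriv (pointwise_prod f r) y (dirs_rep k v \<gamma>) =
    (\<Sum>\<alpha>\<in>decompositions r k \<gamma>. multinomial r k \<gamma> \<alpha> *\<^sub>R
      ordered_prod (\<lambda>a. dir_deriv (f a) y (dirs_rep k v (\<alpha> a))) r)"
  using \<gamma> assms(4,5)
proof (induction \<gamma> arbitrary: y rule: multi_index_induct)
  case zero
  have "\<alpha> a = 0" if "\<alpha> \<in> decompositions r k 0" "a \<in> {1..r}" for \<alpha> a
  proof (rule poly_mapping_eqI)
    show "Poly_Mapping.lookup (\<alpha> a) i = Poly_Mapping.lookup 0 i" for i
      using lookup_decomposition[OF that(1), of i] that(2) by simp
  qed
  then have "decompositions r k 0 = {\<lambda>a\<in>{1..r}. 0}"
    by (auto simp: decompositions_def PiE_iff extensional_def fun_eq_iff multi_indices_iff)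
  moreover have nil: "dirs_rep k v 0 = []"
    by (simp add: dirs_rep_def mi_list_def concat_eq_Nil_conv)
  moreover have "ordered_prod (\<lambda>a. dir_deriv (f a) y (dirs_rep k v ((\<lambda>a\<in>{1..r}. 0) a))) r =
      ordered_prod (\<lambda>a. f a y) r"
    using r nil by (intro ordered_prod_cong) (auto simp: dir_deriv_Nil)
  ultimately show ?case
    by (simp add: dir_deriv_Nil pointwise_prod_def mi_fact_def)
next
  case (add_single i \<gamma>)
  let ?e = "Poly_Mapping.single i 1 :: nat \<Rightarrow>\<^sub>0 nat"
  have size: "mi_size k \<gamma> < n"
    using add_single.prems(1) unfolding mi_size_add mi_size_single[OF add_single.hyps(1)] by simp
  have Cons: "dirs_rep k v (?e + \<beta>) = v i # dirs_rep k v \<beta>"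
    if "\<And>j. j < i \<Longrightarrow> Poly_Mapping.lookup \<beta> j = 0" for \<beta>
    unfolding dirs_rep_def using mi_list_add_single[OF add_single.hyps(1) that] by simp
  have "dir_deriv (pointwise_prod f r) y (v i # dirs_rep k v \<gamma>) =
    (\<Sum>\<alpha>\<in>decompositions r k \<gamma>. multinomial r k \<gamma> \<alpha> *\<^sub>R
      (\<Sum>b = 1..r. ordered_prod (\<lambda>a. dir_deriv (f a) y
        (((\<lambda>a. dirs_rep k v (\<alpha> a))(b := v i # dirs_rep k v (\<alpha> b))) a)) r))"
  proof (rule leibniz_step[OF r f])
    show "length (dirs_rep k v (\<alpha> a)) < n" if "\<alpha> \<in> decompositions r k \<gamma>" "a \<in> {1..r}" for \<alpha> a
      using mi_size_decomposition_le[OF that] size by (simp add: length_dirs_rep)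
  qed (use add_single size in \<open>simp_all add: length_dirs_rep\<close>)
  also have "\<dots> = (\<Sum>\<alpha>\<in>decompositions r k \<gamma>. multinomial r k \<gamma> \<alpha> *\<^sub>R
      (\<Sum>b = 1..r. ordered_prod (\<lambda>a. dir_deriv (f a) y
        (dirs_rep k v ((\<alpha>(b := ?e + \<alpha> b)) a))) r))"
  proof (intro sum.cong refl arg_cong2[of _ _ _ _ scaleR] ordered_prod_cong r)
    fix \<alpha> b a assume \<alpha>: "\<alpha> \<in> decompositions r k \<gamma>" and "a \<in> {1..r}" and b: "b \<in> {1..r}"
    have "dirs_rep k v (?e + \<alpha> b) = v i # dirs_rep k v (\<alpha> b)"
    proof (rule Cons)
      show "Poly_Mapping.lookup (\<alpha> b) j = 0" if "j < i" for j
        using lookup_decomposition[OF \<alpha>, of j] add_single.hyps(3)[OF that] b by simp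
    qed
    then show "dir_deriv (f a) y (((\<lambda>a. dirs_rep k v (\<alpha> a))(b := v i # dirs_rep k v (\<alpha> b))) a) =
        dir_deriv (f a) y (dirs_rep k v ((\<alpha>(b := ?e + \<alpha> b)) a))"
      by simp
  qed
  also have "\<dots> = (\<Sum>\<alpha>\<in>decompositions r k (?e + \<gamma>). multinomial r k (?e + \<gamma>) \<alpha> *\<^sub>R
      ordered_prod (\<lambda>a. dir_deriv (f a) y (dirs_rep k v (\<alpha> a))) r)"
    by (rule sum_decompositions_add_single[OF add_single.hyps(1)])
  finally show ?case
    by (subst Cons[OF add_single.hyps(3)])
qed

section \<open>The square-free part of the Taylor polynomial\<close>

lemma has_vector_derivative_dir_deriv_line:
  assumes "C_on n f U" "length ws < n" "z + s *\<^sub>R v \<in> U"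
  shows "((\<lambda>s. dir_deriv f (z + s *\<^sub>R v) ws) has_vector_derivative
    dir_deriv f (z + s *\<^sub>R v) (v # ws)) (at s within T)"
proof -
  note D = C_on_dir_deriv[OF assms]
  have "((\<lambda>s. z + s *\<^sub>R v) has_derivative (\<lambda>h. h *\<^sub>R v)) (at s within T)"
    by (auto intro!: derivative_eq_intros)
  from has_derivative_compose[OF this D]
  show ?thesis
    using linear_scale[OF has_derivative_linear[OF D]]
    by (simp add: has_vector_derivative_def)
qed

lemma continuous_on_dir_deriv:
  assumes "C_on n f U" "length ws \<le> n"
  shows "continuous_on U (\<lambda>y. dir_deriv f y ws)"
  unfolding dir_deriv_def
  by (intro bounded_linear.continuous_on[OF bounded_linear_mlin_apply] C_on_continuous[OF assms])

text \<open>
  A partial derivative in \<open>t\<^sub>i\<close> is a derivative along a line in the direction \<open>v i\<close>, and \<open>foldr\<close> takes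
  the partial derivatives in the order in which \<open>dir_deriv\<close> adds directions in front. The equality
  is needed for all \<open>t\<close> that are mapped into \<open>U\<close>, so that it can be differentiated again.
\<close>

lemma foldr_partial_deriv:
  assumes f: "C_on n f U" and "length is \<le> n" "set is \<subseteq> {1..k}" "x + (\<Sum>i = 1..k. t i *\<^sub>R v i) \<in> U"
  shows "foldr partial_deriv is (\<lambda>t. f (x + (\<Sum>i = 1..k. t i *\<^sub>R v i))) t =
    dir_deriv f (x + (\<Sum>i = 1..k. t i *\<^sub>R v i)) (map v is)"
  using assms(2-4)
proof (induction "is" arbitrary: t)
  case Nil
  then show ?case by (simp add: dir_deriv_Nil)
next
  case (Cons i "is")
  let ?p = "\<lambda>t. x + (\<Sum>i = 1..k. t i *\<^sub>R v i)"
  define z where "z = ?p (t(i := 0))"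
  have line: "?p (t(i := s)) = z + s *\<^sub>R v i" for s
  proof -
    have "(\<Sum>j = 1..k. (t(i := s)) j *\<^sub>R v j) =
        (\<Sum>j = 1..k. (t(i := 0)) j *\<^sub>R v j + (if j = i then s *\<^sub>R v i else 0))"
      by (intro sum.cong) auto
    then show ?thesis
      using Cons.prems(2) by (simp add: z_def sum.distrib)
  qed
  have t: "?p t = z + t i *\<^sub>R v i"
    using line[of "t i"] by (simp only: fun_upd_triv)
  have "((\<lambda>s. dir_deriv f (z + s *\<^sub>R v i) (map v is)) has_vector_derivative
      dir_deriv f (z + t i *\<^sub>R v i) (v i # map v is)) (at (t i))"
    using Cons.prems unfolding t by (intro has_vector_derivative_dir_deriv_line[OF f]) simp_all
  then have "((\<lambda>s. foldr partial_deriv is (\<lambda>t. f (?p t)) (t(i := s))) has_vector_derivative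
      dir_deriv f (z + t i *\<^sub>R v i) (v i # map v is)) (at (t i))"
  proof (rule has_vector_derivative_transform_within_open)
    show "open ((\<lambda>s. z + s *\<^sub>R v i) -` U)"
      using f by (intro open_vimage continuous_intros) (auto simp: C_on_def)
    show "t i \<in> (\<lambda>s. z + s *\<^sub>R v i) -` U"
      using Cons.prems(3) unfolding t by simp
    fix s assume "s \<in> (\<lambda>s. z + s *\<^sub>R v i) -` U"
    then have "?p (t(i := s)) \<in> U" by (simp only: line vimage_eq)
    then have "foldr partial_deriv is (\<lambda>t. f (?p t)) (t(i := s)) = dir_deriv f (?p (t(i := s))) (map v is)"
      using Cons.prems by (intro Cons.IH) simp_all
    then show "dir_deriv f (z + s *\<^sub>R v i) (map v is) = foldr partial_deriv is (\<lambda>t. f (?p t)) (t(i := s))"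
      by (simp only: line)
  qed
  then show ?case
    unfolding t foldr.simps o_apply partial_deriv_def[of i] list.map by (rule vector_derivative_at)
qed

lemma lookup_sqfree_mono:
  "finite J \<Longrightarrow> Poly_Mapping.lookup (sqfree_mono J) i = (if i \<in> J then 1 else 0)"
  by (simp add: sqfree_mono_def lookup_sum lookup_single when_def)

lemma sqfree_mono_multi_indices: "J \<subseteq> {1..k} \<Longrightarrow> sqfree_mono J \<in> multi_indices k"
  by (auto simp: multi_indices_iff lookup_sqfree_mono finite_subset)

lemma mi_size_sqfree_mono: "J \<subseteq> {1..k} \<Longrightarrow> mi_size k (sqfree_mono J) = card J"
  using card_mono[of "{1..k}" J]
  by (simp add: mi_size_def lookup_sqfree_mono finite_subset sum.If_cases Int_absorb1)

lemma mi_fact_sqfree_mono: "J \<subseteq> {1..k} \<Longrightarrow> mi_fact k (sqfree_mono J) = 1"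
  by (auto simp: mi_fact_def lookup_sqfree_mono finite_subset intro!: prod.neutral)

lemma mi_list_sqfree_mono:
  assumes "J \<subseteq> {1..k}"
  shows "mi_list k (sqfree_mono J) = sorted_list_of_set J"
proof -
  have fin: "finite J" using assms by (rule finite_subset) simp
  have concat: "concat (map (\<lambda>i. replicate (if i \<in> J then 1 else 0) i) xs) = filter (\<lambda>i. i \<in> J) xs" for xs
    by (induction xs) auto
  have "filter (\<lambda>i. i \<in> J) [1..<Suc k] = sorted_list_of_set J"
    using fin assms
    by (intro sorted_distinct_set_unique sorted_wrt_filter distinct_filter)
      (auto simp del: upt_Suc)
  then show ?thesis
    unfolding mi_list_def lookup_sqfree_mono[OF fin] concat .
qed

lemma dirs_rep_sqfree_mono: "J \<subseteq> {1..k} \<Longrightarrow> dirs_rep k v (sqfree_mono J) = dirs_set v J"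
  by (simp add: dirs_rep_def dirs_set_def mi_list_sqfree_mono)

lemma set_mi_list: "set (mi_list k \<alpha>) \<subseteq> {1..k}"
  by (auto simp: mi_list_def)

lemma lookup_taylor_poly:
  assumes "\<alpha> \<in> multi_indices k" "mi_size k \<alpha> \<le> n"
  shows "Poly_Mapping.lookup (taylor_poly k n g) \<alpha> = (1 / mi_fact k \<alpha>) *\<^sub>R mi_partial k \<alpha> g (\<lambda>_. 0)"
  using assms finite_multi_indices_le[of k n]
  by (simp add: taylor_poly_def lookup_sum lookup_single when_def)

lemma sqfree_part_taylor_poly:
  fixes f :: "'a::real_normed_vector \<Rightarrow> 'b::real_normed_vector"
  assumes f: "C_on n f U" and "x \<in> U" "k \<le> n"
  shows "sqfree_part k (taylor_poly k n (\<lambda>t. f (x + (\<Sum>i = 1..k. t i *\<^sub>R v i)))) =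
    (\<Sum>J\<in>Pow {1..k}. Poly_Mapping.single (sqfree_mono J) (dir_deriv f x (dirs_set v J)))"
  unfolding sqfree_part_def
proof (intro sum.cong refl arg_cong[of _ _ "Poly_Mapping.single _"])
  fix J :: "nat set" assume "J \<in> Pow {1..k}"
  then have J: "J \<subseteq> {1..k}" by simp
  have size: "mi_size k (sqfree_mono J) \<le> n"
    using card_mono[OF _ J] assms(3) by (simp add: mi_size_sqfree_mono[OF J])
  have "mi_partial k (sqfree_mono J) (\<lambda>t. f (x + (\<Sum>i = 1..k. t i *\<^sub>R v i))) (\<lambda>_. 0) =
      dir_deriv f x (map v (mi_list k (sqfree_mono J)))"
    unfolding mi_partial_def
    using foldr_partial_deriv[OF f, of "mi_list k (sqfree_mono J)" k x "\<lambda>_. 0" v] size assms(2)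
      set_mi_list[of k "sqfree_mono J"] by (simp add: length_mi_list)
  then show "Poly_Mapping.lookup (taylor_poly k n (\<lambda>t. f (x + (\<Sum>i = 1..k. t i *\<^sub>R v i)))) (sqfree_mono J) =
      dir_deriv f x (dirs_set v J)"
    using dirs_rep_sqfree_mono[OF J, of v]
    by (simp add: lookup_taylor_poly[OF sqfree_mono_multi_indices[OF J] size]
        mi_fact_sqfree_mono[OF J] dirs_rep_def)
qed

section \<open>Taylor expansion, one coordinate at a time\<close>

lemma dist_line_less:
  assumes "dist z x < d / (1 + norm v)" "\<bar>s\<bar> < d / (1 + norm v)"
  shows "dist (z + s *\<^sub>R v) x < d"
proof -
  have "1 + norm v > 0" by (simp add: add_pos_nonneg)
  have "dist (z + s *\<^sub>R v) x \<le> dist z x + \<bar>s\<bar> * norm v"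
    using norm_triangle_ineq[of "z - x" "s *\<^sub>R v"] by (simp add: dist_norm algebra_simps)
  also have "\<dots> < d / (1 + norm v) + d / (1 + norm v) * norm v"
    using assms by (intro add_less_le_mono mult_right_mono) auto
  also have "\<dots> = d / (1 + norm v) * (1 + norm v)"
    by (simp only: distrib_left mult_1_right)
  also have "\<dots> = d" using \<open>1 + norm v > 0\<close> by simp
  finally show ?thesis .
qed

text \<open>
  One-dimensional Taylor expansion, in the direction \<open>v\<close>, of a derivative that is already taken in
  the directions \<open>ws\<close>. The base point \<open>z\<close> may vary near \<open>x\<close>, because it depends on the other
  coordinates when the lemma is used. The derivative with respect to \<open>s\<close> of the remainder of order
  \<open>Suc m\<close> for \<open>ws\<close> is the remainder of order \<open>m\<close> for \<open>v # ws\<close>; so the mean value inequality reduces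
  the claim to \<open>m = 0\<close>, which is continuity at \<open>x\<close>.
\<close>

lemma taylor_line_uniform:
  fixes f :: "'a::real_normed_vector \<Rightarrow> 'b::real_normed_vector"
  assumes f: "C_on n f U" and x: "x \<in> U" and len: "length ws + m \<le> n" and "0 < e"
  shows "\<exists>d>0. \<forall>z s. dist z x < d \<longrightarrow> \<bar>s\<bar> < d \<longrightarrow>
    norm (dir_deriv f (z + s *\<^sub>R v) ws -
      (\<Sum>j\<le>m. (s ^ j / fact j) *\<^sub>R dir_deriv f z (replicate j v @ ws))) \<le> e * \<bar>s\<bar> ^ m"
  using len
proof (induction m arbitrary: ws)
  case 0
  have U: "open U" using f by (simp add: C_on_def)
  have "isCont (\<lambda>y. dir_deriv f y ws) x"
    using continuous_on_dir_deriv[OF f, of ws] 0 U x by (simp add: continuous_on_eq_continuous_at)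
  then obtain d where "d > 0" and d: "\<And>y. dist y x < d \<Longrightarrow> dist (dir_deriv f y ws) (dir_deriv f x ws) < e / 2"
    using \<open>0 < e\<close> unfolding continuous_at_eps_delta by (meson half_gt_zero)
  let ?d = "d / (1 + norm v)"
  have pos: "1 + norm v > 0" by (simp add: add_pos_nonneg)
  have "?d > 0" using \<open>d > 0\<close> pos by simp
  show ?case
  proof (intro exI[of _ ?d] conjI allI impI)
    fix z s assume z: "dist z x < ?d" and s: "\<bar>s\<bar> < ?d"
    have 1: "dist (z + s *\<^sub>R v) x < d"
      using z s by (rule dist_line_less)
    have "?d \<le> d" using \<open>d > 0\<close> pos by (simp add: divide_le_eq distrib_left)
    then have 2: "dist z x < d" using z by linarith
    show "norm (dir_deriv f (z + s *\<^sub>R v) ws -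
      (\<Sum>j\<le>0. (s ^ j / fact j) *\<^sub>R dir_deriv f z (replicate j v @ ws))) \<le> e * \<bar>s\<bar> ^ 0"
      using dist_triangle_half_l[OF d[OF 1] d[OF 2]] by (simp add: dist_norm)
  qed fact
next
  case (Suc m)
  from Suc.IH[of "v # ws"] Suc.prems obtain d where "d > 0"
    and d: "\<And>z s. dist z x < d \<Longrightarrow> \<bar>s\<bar> < d \<Longrightarrow> norm (dir_deriv f (z + s *\<^sub>R v) (v # ws) -
      (\<Sum>j\<le>m. (s ^ j / fact j) *\<^sub>R dir_deriv f z (replicate j v @ v # ws))) \<le> e * \<bar>s\<bar> ^ m"
    by auto
  have "open U" using f by (simp add: C_on_def)
  then obtain d' where "d' > 0" and d': "ball x d' \<subseteq> U"
    using x open_contains_ball by blast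
  define \<delta> where "\<delta> = min d (d' / (1 + norm v))"
  have pos: "1 + norm v > 0" by (simp add: add_pos_nonneg)
  have "\<delta> > 0" using \<open>d > 0\<close> \<open>d' > 0\<close> pos by (simp add: \<delta>_def)
  show ?case
  proof (intro exI[of _ \<delta>] conjI allI impI)
    fix z s assume z: "dist z x < \<delta>" and s: "\<bar>s\<bar> < \<delta>"
    let ?R = "\<lambda>u. dir_deriv f (z + u *\<^sub>R v) ws -
      (\<Sum>j\<le>Suc m. (u ^ j / fact j) *\<^sub>R dir_deriv f z (replicate j v @ ws))"
    let ?R' = "\<lambda>u. dir_deriv f (z + u *\<^sub>R v) (v # ws) -
      (\<Sum>j\<le>m. (u ^ j / fact j) *\<^sub>R dir_deriv f z (replicate j v @ v # ws))"
    have inU: "z + u *\<^sub>R v \<in> U" if "\<bar>u\<bar> < \<delta>" for u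
    proof -
      have "dist (z + u *\<^sub>R v) x < d'"
        using z that by (intro dist_line_less) (simp_all add: \<delta>_def)
      then show ?thesis using d' by (auto simp: dist_commute)
    qed
    have R': "(?R has_derivative (\<lambda>h. h *\<^sub>R ?R' u)) (at u within T)" if "\<bar>u\<bar> < \<delta>" for u T
    proof -
      have "((\<lambda>u. \<Sum>j\<le>Suc m. (u ^ j / fact j) *\<^sub>R dir_deriv f z (replicate j v @ ws))
          has_vector_derivative (\<Sum>j\<le>m. (u ^ j / fact j) *\<^sub>R dir_deriv f z (replicate j v @ v # ws)))
          (at u within T)"
      proof -
        have "((\<lambda>u. (u ^ Suc j / fact (Suc j)) *\<^sub>R c) has_vector_derivative (u ^ j / fact j) *\<^sub>R c) (at u within T)"
          for j and c :: 'b
        proof -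
          have "((\<lambda>u. u ^ Suc j / fact (Suc j)) has_field_derivative
              real (Suc j) * u ^ j / fact (Suc j)) (at u within T)"
            by (auto intro!: derivative_eq_intros simp del: power_Suc)
          moreover have "real (Suc j) * u ^ j / fact (Suc j) = u ^ j / fact j"
            by (simp del: of_nat_Suc)
          ultimately show ?thesis
            using has_vector_derivative_scaleR[of "\<lambda>u. u ^ Suc j / fact (Suc j)" "u ^ j / fact j" u T "\<lambda>_. c" 0]
            by (simp del: fact_Suc power_Suc)
        qed
        then have "((\<lambda>u. dir_deriv f z ws + (\<Sum>j\<le>m. (u ^ Suc j / fact (Suc j)) *\<^sub>R dir_deriv f z (replicate (Suc j) v @ ws)))
          has_vector_derivative 0 + (\<Sum>j\<le>m. (u ^ j / fact j) *\<^sub>R dir_deriv f z (replicate (Suc j) v @ ws)))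
          (at u within T)"
          by (intro has_vector_derivative_add has_vector_derivative_const has_vector_derivative_sum)
        then show ?thesis
          by (subst sum.atMost_Suc_shift) (simp add: replicate_app_Cons_same)
      qed
      moreover have "((\<lambda>u. dir_deriv f (z + u *\<^sub>R v) ws) has_vector_derivative
          dir_deriv f (z + u *\<^sub>R v) (v # ws)) (at u within T)"
        using Suc.prems inU[OF that] by (intro has_vector_derivative_dir_deriv_line[OF f]) auto
      ultimately have "(?R has_vector_derivative ?R' u) (at u within T)"
        by (intro has_vector_derivative_diff)
      then show ?thesis by (simp add: has_vector_derivative_def)
    qed
    have "norm (?R s - ?R 0) \<le> (e * \<bar>s\<bar> ^ m) * norm (s - 0)"
    proof (rule differentiable_bound[of "closed_segment 0 s" ?R "\<lambda>u h. h *\<^sub>R ?R' u"])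
      fix u assume "u \<in> closed_segment 0 s"
      then have u: "\<bar>u\<bar> \<le> \<bar>s\<bar>"
        by (auto simp: closed_segment_eq_real_ivl split: if_splits)
      show "(?R has_derivative (\<lambda>h. h *\<^sub>R ?R' u)) (at u within closed_segment 0 s)"
        using u s by (intro R') simp
      have "norm (?R' u) \<le> e * \<bar>u\<bar> ^ m"
        using z u s by (intro d) (simp_all add: \<delta>_def)
      also have "\<dots> \<le> e * \<bar>s\<bar> ^ m"
        using u \<open>0 < e\<close> by (intro mult_left_mono power_mono) auto
      finally have "norm (?R' u) \<le> e * \<bar>s\<bar> ^ m" .
      then show "onorm (\<lambda>h. h *\<^sub>R ?R' u) \<le> e * \<bar>s\<bar> ^ m"
        by (intro onorm_le) (simp add: mult.commute mult_left_mono)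
    qed auto
    moreover have "?R 0 = 0"
      by (subst sum.atMost_Suc_shift) simp
    ultimately show "norm (?R s) \<le> e * \<bar>s\<bar> ^ Suc m"
      by (simp only: diff_zero real_norm_def power_Suc2 mult.assoc)
  qed fact
qed

lemma mi_list_Suc:
  "mi_list (Suc j) \<alpha> = mi_list j \<alpha> @ replicate (Poly_Mapping.lookup \<alpha> (Suc j)) (Suc j)"
  by (simp add: mi_list_def)

lemma mi_list_cong:
  assumes "\<And>i. i \<in> {1..j} \<Longrightarrow> Poly_Mapping.lookup \<alpha> i = Poly_Mapping.lookup \<beta> i"
  shows "mi_list j \<alpha> = mi_list j \<beta>"
  unfolding mi_list_def using assms by (intro arg_cong[of _ _ concat] map_cong) auto

lemma multi_indices_Suc:
  assumes "\<beta> \<in> multi_indices j"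
  shows "Poly_Mapping.single (Suc j) a + \<beta> \<in> multi_indices (Suc j)"
    and "Poly_Mapping.lookup (Poly_Mapping.single (Suc j) a + \<beta>) (Suc j) = a"
    and "mi_size (Suc j) (Poly_Mapping.single (Suc j) a + \<beta>) = a + mi_size j \<beta>"
    and "mi_fact (Suc j) (Poly_Mapping.single (Suc j) a + \<beta>) = fact a * mi_fact j \<beta>"
    and "mi_power (Suc j) t (Poly_Mapping.single (Suc j) a + \<beta>) = t (Suc j) ^ a * mi_power j t \<beta>"
    and "dirs_rep (Suc j) v (Poly_Mapping.single (Suc j) a + \<beta>) = dirs_rep j v \<beta> @ replicate a (v (Suc j))"
proof -
  let ?\<alpha> = "Poly_Mapping.single (Suc j) a + \<beta>"
  show "?\<alpha> \<in> multi_indices (Suc j)"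
    using assms by (auto simp: multi_indices_iff lookup_add lookup_single when_def)
  have eq: "Poly_Mapping.lookup ?\<alpha> i = Poly_Mapping.lookup \<beta> i" if "i \<in> {1..j}" for i
    using that by (simp add: lookup_add lookup_single)
  show last: "Poly_Mapping.lookup ?\<alpha> (Suc j) = a"
    using assms by (simp add: multi_indices_iff lookup_add)
  show "mi_size (Suc j) ?\<alpha> = a + mi_size j \<beta>"
    using last eq by (simp add: mi_size_def)
  show "mi_fact (Suc j) ?\<alpha> = fact a * mi_fact j \<beta>"
    using last eq by (simp add: mi_fact_def)
  show "mi_power (Suc j) t ?\<alpha> = t (Suc j) ^ a * mi_power j t \<beta>"
    using last eq by (simp add: mi_power_def)
  show "dirs_rep (Suc j) v ?\<alpha> = dirs_rep j v \<beta> @ replicate a (v (Suc j))"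
  proof -
    have "mi_list j ?\<alpha> = mi_list j \<beta>"
      by (rule mi_list_cong) (rule eq)
    then show ?thesis
      unfolding dirs_rep_def mi_list_Suc last by simp
  qed
qed

text \<open>
  The order of summation in which the expansion by the last coordinate first produces the terms of
  the Taylor formula.
\<close>

lemma sum_multi_indices_Suc:
  "(\<Sum>\<alpha> | \<alpha> \<in> multi_indices (Suc j) \<and> mi_size (Suc j) \<alpha> \<le> m. h \<alpha>) =
   (\<Sum>a\<le>m. \<Sum>\<beta> | \<beta> \<in> multi_indices j \<and> mi_size j \<beta> \<le> m - a. h (Poly_Mapping.single (Suc j) a + \<beta>))"
proof -
  let ?e = "\<lambda>a. Poly_Mapping.single (Suc j) a :: nat \<Rightarrow>\<^sub>0 nat"
  have "(\<Sum>a\<le>m. \<Sum>\<beta> | \<beta> \<in> multi_indices j \<and> mi_size j \<beta> \<le> m - a. h (?e a + \<beta>)) =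
      (\<Sum>(a, \<beta>)\<in>(SIGMA a:{..m}. {\<beta>. \<beta> \<in> multi_indices j \<and> mi_size j \<beta> \<le> m - a}). h (?e a + \<beta>))"
    by (rule sum.Sigma) (auto intro: finite_multi_indices_le)
  also have "\<dots> = (\<Sum>\<alpha> | \<alpha> \<in> multi_indices (Suc j) \<and> mi_size (Suc j) \<alpha> \<le> m. h \<alpha>)"
  proof (rule sum.reindex_bij_witness[of _
      "\<lambda>\<alpha>. (Poly_Mapping.lookup \<alpha> (Suc j), \<alpha> - ?e (Poly_Mapping.lookup \<alpha> (Suc j)))" "\<lambda>(a, \<beta>). ?e a + \<beta>"])
    fix \<alpha> assume \<alpha>: "\<alpha> \<in> {\<alpha>. \<alpha> \<in> multi_indices (Suc j) \<and> mi_size (Suc j) \<alpha> \<le> m}"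
    define a \<beta> where "a = Poly_Mapping.lookup \<alpha> (Suc j)" and "\<beta> = \<alpha> - ?e a"
    have \<beta>: "\<beta> \<in> multi_indices j"
      using \<alpha> unfolding multi_indices_iff
      by (auto simp: \<beta>_def a_def lookup_minus lookup_single when_def not_less_eq_eq le_Suc_eq)
    have eq: "?e a + \<beta> = \<alpha>"
      by (rule poly_mapping_eqI) (simp add: \<beta>_def a_def lookup_add lookup_minus lookup_single when_def)
    show "(case (Poly_Mapping.lookup \<alpha> (Suc j), \<alpha> - ?e (Poly_Mapping.lookup \<alpha> (Suc j))) of (a, \<beta>) \<Rightarrow> ?e a + \<beta>) = \<alpha>"
      using eq by (simp add: a_def \<beta>_def)
    show "(Poly_Mapping.lookup \<alpha> (Suc j), \<alpha> - ?e (Poly_Mapping.lookup \<alpha> (Suc j))) \<in>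
        (SIGMA a:{..m}. {\<beta>. \<beta> \<in> multi_indices j \<and> mi_size j \<beta> \<le> m - a})"
      using \<alpha> \<beta> multi_indices_Suc(3)[OF \<beta>, of a] unfolding eq by (auto simp: a_def \<beta>_def)
  next
    fix p assume "p \<in> (SIGMA a:{..m}. {\<beta>. \<beta> \<in> multi_indices j \<and> mi_size j \<beta> \<le> m - a})"
    then obtain a \<beta> where [simp]: "p = (a, \<beta>)" and *: "a \<le> m" "\<beta> \<in> multi_indices j" "mi_size j \<beta> \<le> m - a"
      by auto
    show "(case p of (a, \<beta>) \<Rightarrow> ?e a + \<beta>) \<in> {\<alpha>. \<alpha> \<in> multi_indices (Suc j) \<and> mi_size (Suc j) \<alpha> \<le> m}"
      using * multi_indices_Suc(1,3)[OF *(2), of a] by simp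
    show "(Poly_Mapping.lookup (case p of (a, \<beta>) \<Rightarrow> ?e a + \<beta>) (Suc j), (case p of (a, \<beta>) \<Rightarrow> ?e a + \<beta>) -
        ?e (Poly_Mapping.lookup (case p of (a, \<beta>) \<Rightarrow> ?e a + \<beta>) (Suc j))) = p"
      using multi_indices_Suc(2)[OF *(2), of a] by simp
  qed auto
  finally show ?thesis by (rule sym)
qed

lemma rk_norm_nonneg: "0 \<le> rk_norm k t"
  by (simp add: rk_norm_def)

lemma abs_le_rk_norm: "i \<in> {1..k} \<Longrightarrow> \<bar>t i\<bar> \<le> rk_norm k t"
  using member_le_L2_set[of "{1..k}" i "\<lambda>i. \<bar>t i\<bar>"] by (simp add: rk_norm_def L2_set_def)

lemma tendsto_rk_norm: "(rk_norm k \<longlongrightarrow> 0) (rk_zero_filter k)"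
  unfolding rk_zero_filter_def by (rule filterlim_filtercomap)

lemma tendsto_rk_coordinate: "i \<in> {1..k} \<Longrightarrow> ((\<lambda>t. t i) \<longlongrightarrow> 0) (rk_zero_filter k)"
  by (rule Lim_null_comparison[OF always_eventually tendsto_rk_norm]) (simp add: abs_le_rk_norm)

lemma tendsto_rk_point:
  assumes "j \<le> k"
  shows "((\<lambda>t. x + (\<Sum>i = 1..j. t i *\<^sub>R v i)) \<longlongrightarrow> (x :: 'a::real_normed_vector)) (rk_zero_filter k)"
proof -
  have "((\<lambda>t. x + (\<Sum>i = 1..j. t i *\<^sub>R v i)) \<longlongrightarrow> x + (\<Sum>i = 1..j. 0 *\<^sub>R v i)) (rk_zero_filter k)"
    using assms by (intro tendsto_intros tendsto_rk_coordinate) auto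
  then show ?thesis by simp
qed

lemma taylor_line_smallo:
  fixes f :: "'a::real_normed_vector \<Rightarrow> 'b::real_normed_vector"
  assumes f: "C_on n f U" and x: "x \<in> U" and len: "length ws + m \<le> n" and j: "Suc j \<le> k"
  shows "(\<lambda>t. norm (dir_deriv f (x + (\<Sum>i = 1..j. t i *\<^sub>R v i) + t (Suc j) *\<^sub>R w) ws -
      (\<Sum>a\<le>m. (t (Suc j) ^ a / fact a) *\<^sub>R
        dir_deriv f (x + (\<Sum>i = 1..j. t i *\<^sub>R v i)) (replicate a w @ ws))))
    \<in> o[rk_zero_filter k](\<lambda>t. rk_norm k t ^ m)"
proof (rule landau_o.smallI)
  fix c :: real assume "c > 0"
  from taylor_line_uniform[OF f x len this, of w] obtain d where "d > 0"
    and d: "\<And>z s. dist z x < d \<Longrightarrow> \<bar>s\<bar> < d \<Longrightarrow> norm (dir_deriv f (z + s *\<^sub>R w) ws -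
      (\<Sum>a\<le>m. (s ^ a / fact a) *\<^sub>R dir_deriv f z (replicate a w @ ws))) \<le> c * \<bar>s\<bar> ^ m"
    by blast
  have "eventually (\<lambda>t. dist (x + (\<Sum>i = 1..j. t i *\<^sub>R v i)) x < d) (rk_zero_filter k)"
    using j by (intro tendstoD[OF tendsto_rk_point \<open>d > 0\<close>]) simp
  moreover have "eventually (\<lambda>t. rk_norm k t < d) (rk_zero_filter k)"
    using order_tendstoD(2)[OF tendsto_rk_norm \<open>d > 0\<close>] .
  ultimately show "eventually (\<lambda>t. norm (norm (dir_deriv f (x + (\<Sum>i = 1..j. t i *\<^sub>R v i) + t (Suc j) *\<^sub>R w) ws -
      (\<Sum>a\<le>m. (t (Suc j) ^ a / fact a) *\<^sub>R
        dir_deriv f (x + (\<Sum>i = 1..j. t i *\<^sub>R v i)) (replicate a w @ ws))))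
      \<le> c * norm (rk_norm k t ^ m)) (rk_zero_filter k)"
  proof eventually_elim
    case (elim t)
    have le: "\<bar>t (Suc j)\<bar> \<le> rk_norm k t" using j by (intro abs_le_rk_norm) simp
    have "c * \<bar>t (Suc j)\<bar> ^ m \<le> c * rk_norm k t ^ m"
      using le \<open>c > 0\<close> by (intro mult_left_mono power_mono) auto
    with d[OF elim(1), of "t (Suc j)"] le elim(2) show ?case
      by (simp add: rk_norm_nonneg)
  qed
qed

lemma norm_diff_sum_scaleR_le:
  fixes X :: "'b::real_normed_vector"
  shows "norm (X - (\<Sum>a\<in>S. c a *\<^sub>R T a)) \<le>
    norm (X - (\<Sum>a\<in>S. c a *\<^sub>R Y a)) + (\<Sum>a\<in>S. \<bar>c a\<bar> * norm (Y a - T a))"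
proof -
  have "X - (\<Sum>a\<in>S. c a *\<^sub>R T a) =
      (X - (\<Sum>a\<in>S. c a *\<^sub>R Y a)) + (\<Sum>a\<in>S. c a *\<^sub>R (Y a - T a))"
    by (simp add: scaleR_diff_right sum_subtractf)
  then have "norm (X - (\<Sum>a\<in>S. c a *\<^sub>R T a)) \<le>
      norm (X - (\<Sum>a\<in>S. c a *\<^sub>R Y a)) + norm (\<Sum>a\<in>S. c a *\<^sub>R (Y a - T a))"
    by (metis norm_triangle_ineq)
  also have "norm (\<Sum>a\<in>S. c a *\<^sub>R (Y a - T a)) \<le> (\<Sum>a\<in>S. \<bar>c a\<bar> * norm (Y a - T a))"
    by (rule sum_norm_le) simp
  finally show ?thesis by simp
qed

text \<open>
  Multivariate Taylor expansion. The last coordinate \<open>t\<^sub>j\<^sub>+\<^sub>1\<close> is expanded first, with the others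
  fixed; the coefficient of \<open>t\<^sub>j\<^sub>+\<^sub>1\<^sup>a\<close> is a derivative of order \<open>a\<close> in the direction \<open>v\<^sub>j\<^sub>+\<^sub>1\<close>, and is then
  expanded in the remaining coordinates to order \<open>m - a\<close>. Each later expansion puts directions of
  smaller index in front, so they end up in the order of \<open>dirs_rep\<close>. The general list \<open>ws\<close> collects the directions already used.
\<close>

lemma taylor_coordinates:
  fixes f :: "'a::real_normed_vector \<Rightarrow> 'b::real_normed_vector"
  assumes f: "C_on n f U" and x: "x \<in> U" and "length ws + m \<le> n" and "j \<le> k"
  shows "(\<lambda>t. norm (dir_deriv f (x + (\<Sum>i = 1..j. t i *\<^sub>R v i)) ws -
      (\<Sum>\<alpha> | \<alpha> \<in> multi_indices j \<and> mi_size j \<alpha> \<le> m.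
        (mi_power j t \<alpha> / mi_fact j \<alpha>) *\<^sub>R dir_deriv f x (dirs_rep j v \<alpha> @ ws))))
    \<in> o[rk_zero_filter k](\<lambda>t. rk_norm k t ^ m)"
  using assms(3,4)
proof (induction j arbitrary: ws m)
  case 0
  have "{\<alpha>. \<alpha> \<in> multi_indices 0 \<and> mi_size 0 \<alpha> \<le> m} = {0}"
    by (auto simp: multi_indices_def mi_size_def)
  then show ?case
    by (simp add: mi_power_def mi_fact_def dirs_rep_def mi_list_def)
next
  case (Suc j)
  let ?z = "\<lambda>t. x + (\<Sum>i = 1..j. t i *\<^sub>R v i)"
  let ?w = "v (Suc j)"
  let ?D = "\<lambda>a. replicate a ?w @ ws"
  let ?T = "\<lambda>a t. \<Sum>\<beta> | \<beta> \<in> multi_indices j \<and> mi_size j \<beta> \<le> m - a.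
    (mi_power j t \<beta> / mi_fact j \<beta>) *\<^sub>R dir_deriv f x (dirs_rep j v \<beta> @ ?D a)"
  \<comment> \<open>\<open>?R\<close> is the error of expanding the last coordinate, \<open>?E a\<close> the contribution of its \<open>a\<close>-th coefficient.\<close>
  let ?R = "\<lambda>t. norm (dir_deriv f (?z t + t (Suc j) *\<^sub>R ?w) ws -
    (\<Sum>a\<le>m. (t (Suc j) ^ a / fact a) *\<^sub>R dir_deriv f (?z t) (?D a)))"
  let ?E = "\<lambda>a t. \<bar>t (Suc j) ^ a / fact a\<bar> * norm (dir_deriv f (?z t) (?D a) - ?T a t)"
  have R: "?R \<in> o[rk_zero_filter k](\<lambda>t. rk_norm k t ^ m)"
    using Suc.prems by (intro taylor_line_smallo[OF f x])
  have E: "?E a \<in> o[rk_zero_filter k](\<lambda>t. rk_norm k t ^ m)" if a: "a \<in> {..m}" for a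
  proof -
    have "(\<lambda>t. \<bar>t (Suc j) ^ a / fact a\<bar>) \<in> O[rk_zero_filter k](\<lambda>t. rk_norm k t ^ a)"
    proof (rule landau_o.bigI[of "1 / fact a"])
      have "\<bar>t (Suc j)\<bar> ^ a \<le> rk_norm k t ^ a" for t
        using Suc.prems(2) by (intro power_mono abs_le_rk_norm) auto
      then show "eventually (\<lambda>t. norm \<bar>t (Suc j) ^ a / fact a\<bar> \<le> 1 / fact a * norm (rk_norm k t ^ a))
          (rk_zero_filter k)"
        by (intro always_eventually) (simp add: rk_norm_nonneg divide_right_mono power_abs)
    qed simp
    moreover have "(\<lambda>t. norm (dir_deriv f (?z t) (?D a) - ?T a t))
        \<in> o[rk_zero_filter k](\<lambda>t. rk_norm k t ^ (m - a))"
      using Suc.prems a by (intro Suc.IH) auto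
    ultimately have "?E a \<in> o[rk_zero_filter k](\<lambda>t. rk_norm k t ^ a * rk_norm k t ^ (m - a))"
      by (rule landau_o.big_small_mult)
    then show ?thesis using a by (simp flip: power_add)
  qed
  have total: "norm (dir_deriv f (x + (\<Sum>i = 1..Suc j. t i *\<^sub>R v i)) ws -
      (\<Sum>\<alpha> | \<alpha> \<in> multi_indices (Suc j) \<and> mi_size (Suc j) \<alpha> \<le> m.
        (mi_power (Suc j) t \<alpha> / mi_fact (Suc j) \<alpha>) *\<^sub>R dir_deriv f x (dirs_rep (Suc j) v \<alpha> @ ws)))
      \<le> ?R t + (\<Sum>a\<le>m. ?E a t)" for t
  proof -
    have "(\<Sum>\<alpha> | \<alpha> \<in> multi_indices (Suc j) \<and> mi_size (Suc j) \<alpha> \<le> m.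
        (mi_power (Suc j) t \<alpha> / mi_fact (Suc j) \<alpha>) *\<^sub>R dir_deriv f x (dirs_rep (Suc j) v \<alpha> @ ws)) =
        (\<Sum>a\<le>m. (t (Suc j) ^ a / fact a) *\<^sub>R ?T a t)"
      unfolding sum_multi_indices_Suc scaleR_sum_right
      by (intro sum.cong refl) (auto simp: multi_indices_Suc)
    moreover have "x + (\<Sum>i = 1..Suc j. t i *\<^sub>R v i) = ?z t + t (Suc j) *\<^sub>R ?w"
      by (simp add: add.assoc)
    ultimately show ?thesis
      by (simp only: norm_diff_sum_scaleR_le)
  qed
  have "(\<lambda>t. ?R t + (\<Sum>a\<le>m. ?E a t)) \<in> o[rk_zero_filter k](\<lambda>t. rk_norm k t ^ m)"
    using R by (rule sum_in_smallo(1)) (rule big_sum_in_smallo, rule E)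
  then show ?case
  proof (rule landau_o.big_small_trans[rotated])
    show "(\<lambda>t. norm (dir_deriv f (x + (\<Sum>i = 1..Suc j. t i *\<^sub>R v i)) ws -
      (\<Sum>\<alpha> | \<alpha> \<in> multi_indices (Suc j) \<and> mi_size (Suc j) \<alpha> \<le> m.
        (mi_power (Suc j) t \<alpha> / mi_fact (Suc j) \<alpha>) *\<^sub>R dir_deriv f x (dirs_rep (Suc j) v \<alpha> @ ws))))
      \<in> O[rk_zero_filter k](\<lambda>t. ?R t + (\<Sum>a\<le>m. ?E a t))"
    proof (intro landau_o.big_mono always_eventually allI)
      show "norm (norm (dir_deriv f (x + (\<Sum>i = 1..Suc j. t i *\<^sub>R v i)) ws -
        (\<Sum>\<alpha> | \<alpha> \<in> multi_indices (Suc j) \<and> mi_size (Suc j) \<alpha> \<le> m.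
          (mi_power (Suc j) t \<alpha> / mi_fact (Suc j) \<alpha>) *\<^sub>R dir_deriv f x (dirs_rep (Suc j) v \<alpha> @ ws))))
        \<le> norm (?R t + (\<Sum>a\<le>m. ?E a t))" for t
        unfolding real_norm_def abs_norm_cancel by (rule order_trans[OF total abs_ge_self])
    qed
  qed
qed

section \<open>The four product rules\<close>

lemma single_sum:
  "Poly_Mapping.single k (sum h S) = (\<Sum>i\<in>S. Poly_Mapping.single k (h i))"
  by (induction S rule: infinite_finite_induct) (simp_all add: single_add)

text \<open>
  A tuple of disjoint subsets of \<open>[k]\<close> is an ordered partition of its union.
\<close>

lemma sum_disjoint_families:
  "(\<Sum>J | J \<in> {1..r} \<rightarrow>\<^sub>E Pow {1..k} \<and> disjoint_family_on J {1..r}. h J) =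
    (\<Sum>I\<in>Pow {1..k}. \<Sum>J\<in>ordered_partitions r I. h J)"
proof -
  let ?A = "{J. J \<in> {1..r} \<rightarrow>\<^sub>E Pow {1..k} \<and> disjoint_family_on J {1..r}}"
  have "finite ?A"
    by (rule finite_subset[of _ "{1..r} \<rightarrow>\<^sub>E Pow {1..k}"]) (auto intro!: finite_PiE)
  then have "(\<Sum>J\<in>?A. h J) = (\<Sum>I\<in>Pow {1..k}. \<Sum>J | J \<in> ?A \<and> (\<Union>a\<in>{1..r}. J a) = I. h J)"
    by (intro sum.group[symmetric]) (auto simp: PiE_iff)
  also have "\<dots> = (\<Sum>I\<in>Pow {1..k}. \<Sum>J\<in>ordered_partitions r I. h J)"
    by (intro sum.cong refl) (auto simp: ordered_partitions_def PiE_iff)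
  finally show ?thesis .
qed

lemma sum_decompositions_le:
  "(\<Sum>\<alpha> | \<alpha> \<in> {1..r} \<rightarrow>\<^sub>E multi_indices k \<and> mi_size k (\<Sum>a = 1..r. \<alpha> a) \<le> n. h \<alpha>) =
    (\<Sum>\<gamma> | \<gamma> \<in> multi_indices k \<and> mi_size k \<gamma> \<le> n. \<Sum>\<alpha>\<in>decompositions r k \<gamma>. h \<alpha>)"
proof -
  let ?A = "{\<alpha>. \<alpha> \<in> {1..r} \<rightarrow>\<^sub>E multi_indices k \<and> mi_size k (\<Sum>a = 1..r. \<alpha> a) \<le> n}"
  let ?B = "{\<gamma> \<in> multi_indices k. mi_size k \<gamma> \<le> n}"
  have mem: "(\<Sum>a = 1..r. \<alpha> a) \<in> ?B" if "\<alpha> \<in> ?A" for \<alpha>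
    using that by (auto simp: multi_indices_iff PiE_iff lookup_sum)
  have "?A \<subseteq> (\<Union>\<gamma>\<in>?B. decompositions r k \<gamma>)"
    using mem by (auto simp: decompositions_def)
  then have "finite ?A"
    by (rule finite_subset) (intro finite_UN_I finite_multi_indices_le finite_decompositions)
  then have "(\<Sum>\<alpha>\<in>?A. h \<alpha>) = (\<Sum>\<gamma>\<in>?B. \<Sum>\<alpha> | \<alpha> \<in> ?A \<and> (\<Sum>a = 1..r. \<alpha> a) = \<gamma>. h \<alpha>)"
    using mem by (intro sum.group[symmetric] finite_multi_indices_le) auto
  also have "\<dots> = (\<Sum>\<gamma>\<in>?B. \<Sum>\<alpha>\<in>decompositions r k \<gamma>. h \<alpha>)"
    by (intro sum.cong refl) (auto simp: decompositions_def)
  finally show ?thesis .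
qed

theorem theorem44:
  fixes x :: "'a::banach"
    and f :: "nat \<Rightarrow> 'a \<Rightarrow> 'b::{real_normed_algebra, banach}"
    and v :: "nat \<Rightarrow> 'a"
    and r n k :: nat
  assumes r: "1 \<le> r"
    and kn: "k \<le> n"
    and f: "\<And>a. a \<in> {1..r} \<Longrightarrow> C_near n (f a) x"
  shows
    "C_near n (pointwise_prod f r) x \<and>

     dir_deriv (pointwise_prod f r) x (dirs_set v {1..k}) =
       (\<Sum>J | J \<in> {1..r} \<rightarrow>\<^sub>E Pow {1..k} \<and> disjoint_family_on J {1..r} \<and> (\<Union>a\<in>{1..r}. J a) = {1..k}.
          ordered_prod (\<lambda>a. dir_deriv (f a) x (dirs_set v (J a))) r) \<and>

     sqfree_part k (taylor_poly k n (\<lambda>t. pointwise_prod f r (x + (\<Sum>i = 1..k. t i *\<^sub>R v i)))) =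
       (\<Sum>J | J \<in> {1..r} \<rightarrow>\<^sub>E Pow {1..k} \<and> disjoint_family_on J {1..r}.
          Poly_Mapping.single (sqfree_mono (\<Union>a\<in>{1..r}. J a))
            (ordered_prod (\<lambda>a. dir_deriv (f a) x (dirs_set v (J a))) r)) \<and>

     (\<forall>\<gamma>\<in>multi_indices k. mi_size k \<gamma> \<le> n \<longrightarrow>
       dir_deriv (pointwise_prod f r) x (dirs_rep k v \<gamma>) =
         (\<Sum>\<alpha> | \<alpha> \<in> {1..r} \<rightarrow>\<^sub>E multi_indices k \<and> (\<Sum>a = 1..r. \<alpha> a) = \<gamma>.
            (mi_fact k \<gamma> / (\<Prod>a = 1..r. mi_fact k (\<alpha> a))) *\<^sub>R
              ordered_prod (\<lambda>a. dir_deriv (f a) x (dirs_rep k v (\<alpha> a))) r)) \<and>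

     (\<lambda>t. norm (pointwise_prod f r (x + (\<Sum>i = 1..k. t i *\<^sub>R v i)) -
         (\<Sum>\<alpha> | \<alpha> \<in> {1..r} \<rightarrow>\<^sub>E multi_indices k \<and> mi_size k (\<Sum>a = 1..r. \<alpha> a) \<le> n.
            (mi_power k t (\<Sum>a = 1..r. \<alpha> a) / (\<Prod>a = 1..r. mi_fact k (\<alpha> a))) *\<^sub>R
              ordered_prod (\<lambda>a. dir_deriv (f a) x (dirs_rep k v (\<alpha> a))) r)))
       \<in> o[rk_zero_filter k](\<lambda>t. rk_norm k t ^ n)"
proof -
  let ?P = "pointwise_prod f r"
  obtain U where U: "\<And>a. a \<in> {1..r} \<Longrightarrow> x \<in> U a \<and> C_on n (f a) (U a)"
    using f unfolding C_near_iff by metis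
  define V where "V = (\<Inter>a\<in>{1..r}. U a)"
  have V: "open V" "x \<in> V"
    using U unfolding V_def by (auto simp: C_on_def)
  have fV: "C_on n (f a) V" if "a \<in> {1..r}" for a
    using U[OF that] that by (intro C_on_subset[OF _ V(1)]) (auto simp: V_def)
  have P: "C_on n ?P V"
    using r fV by (rule C_on_pointwise_prod)
  have near: "C_near n ?P x"
    using P V(2) unfolding C_near_iff by blast
  have boolean: "dir_deriv ?P x (dirs_set v I) =
      (\<Sum>J\<in>ordered_partitions r I. ordered_prod (\<lambda>a. dir_deriv (f a) x (dirs_set v (J a))) r)"
    if "I \<subseteq> {1..k}" for I
    using that card_mono[of "{1..k}" I] kn V(2)
    by (intro boolean_product_rule[OF r fV]) (auto intro: finite_subset)
  have boolean_taylor: "sqfree_part k (taylor_poly k n (\<lambda>t. ?P (x + (\<Sum>i = 1..k. t i *\<^sub>R v i)))) =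
      (\<Sum>J | J \<in> {1..r} \<rightarrow>\<^sub>E Pow {1..k} \<and> disjoint_family_on J {1..r}.
        Poly_Mapping.single (sqfree_mono (\<Union>a\<in>{1..r}. J a))
          (ordered_prod (\<lambda>a. dir_deriv (f a) x (dirs_set v (J a))) r))"
    unfolding sqfree_part_taylor_poly[OF P V(2) kn] sum_disjoint_families
  proof (intro sum.cong refl)
    fix I assume "I \<in> Pow {1..k}"
    then have "Poly_Mapping.single (sqfree_mono I) (dir_deriv ?P x (dirs_set v I)) =
        (\<Sum>J\<in>ordered_partitions r I. Poly_Mapping.single (sqfree_mono I)
          (ordered_prod (\<lambda>a. dir_deriv (f a) x (dirs_set v (J a))) r))"
      by (simp add: boolean single_sum)
    also have "\<dots> = (\<Sum>J\<in>ordered_partitions r I. Poly_Mapping.single (sqfree_mono (\<Union>a\<in>{1..r}. J a))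
          (ordered_prod (\<lambda>a. dir_deriv (f a) x (dirs_set v (J a))) r))"
      by (intro sum.cong refl) (auto simp: ordered_partitions_def)
    finally show "Poly_Mapping.single (sqfree_mono I) (dir_deriv ?P x (dirs_set v I)) = \<dots>" .
  qed
  have binomial: "dir_deriv ?P x (dirs_rep k v \<gamma>) =
      (\<Sum>\<alpha>\<in>decompositions r k \<gamma>. multinomial r k \<gamma> \<alpha> *\<^sub>R
        ordered_prod (\<lambda>a. dir_deriv (f a) x (dirs_rep k v (\<alpha> a))) r)"
    if "\<gamma> \<in> multi_indices k" "mi_size k \<gamma> \<le> n" for \<gamma>
    using that V(2) by (intro binomial_product_rule[OF r fV])
  have "(\<Sum>\<gamma> | \<gamma> \<in> multi_indices k \<and> mi_size k \<gamma> \<le> n.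
        (mi_power k t \<gamma> / mi_fact k \<gamma>) *\<^sub>R dir_deriv ?P x (dirs_rep k v \<gamma>)) =
      (\<Sum>\<alpha> | \<alpha> \<in> {1..r} \<rightarrow>\<^sub>E multi_indices k \<and> mi_size k (\<Sum>a = 1..r. \<alpha> a) \<le> n.
        (mi_power k t (\<Sum>a = 1..r. \<alpha> a) / (\<Prod>a = 1..r. mi_fact k (\<alpha> a))) *\<^sub>R
          ordered_prod (\<lambda>a. dir_deriv (f a) x (dirs_rep k v (\<alpha> a))) r)" for t
    unfolding sum_decompositions_le
  proof (intro sum.cong refl)
    fix \<gamma> assume "\<gamma> \<in> {\<gamma>. \<gamma> \<in> multi_indices k \<and> mi_size k \<gamma> \<le> n}"
    then have "(mi_power k t \<gamma> / mi_fact k \<gamma>) *\<^sub>R dir_deriv ?P x (dirs_rep k v \<gamma>) =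
        (\<Sum>\<alpha>\<in>decompositions r k \<gamma>. (mi_power k t \<gamma> / mi_fact k \<gamma> * multinomial r k \<gamma> \<alpha>) *\<^sub>R
          ordered_prod (\<lambda>a. dir_deriv (f a) x (dirs_rep k v (\<alpha> a))) r)"
      by (simp add: binomial scaleR_sum_right)
    also have "\<dots> = (\<Sum>\<alpha>\<in>decompositions r k \<gamma>.
        (mi_power k t (\<Sum>a = 1..r. \<alpha> a) / (\<Prod>a = 1..r. mi_fact k (\<alpha> a))) *\<^sub>R
          ordered_prod (\<lambda>a. dir_deriv (f a) x (dirs_rep k v (\<alpha> a))) r)"
      using mi_fact_pos[of k \<gamma>]
      by (intro sum.cong refl arg_cong2[of _ _ _ _ scaleR]) (auto simp: decompositions_def)
    finally show "(mi_power k t \<gamma> / mi_fact k \<gamma>) *\<^sub>R dir_deriv ?P x (dirs_rep k v \<gamma>) = \<dots>" .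
  qed
  then have binomial_taylor: "(\<lambda>t. norm (?P (x + (\<Sum>i = 1..k. t i *\<^sub>R v i)) -
         (\<Sum>\<alpha> | \<alpha> \<in> {1..r} \<rightarrow>\<^sub>E multi_indices k \<and> mi_size k (\<Sum>a = 1..r. \<alpha> a) \<le> n.
            (mi_power k t (\<Sum>a = 1..r. \<alpha> a) / (\<Prod>a = 1..r. mi_fact k (\<alpha> a))) *\<^sub>R
              ordered_prod (\<lambda>a. dir_deriv (f a) x (dirs_rep k v (\<alpha> a))) r)))
       \<in> o[rk_zero_filter k](\<lambda>t. rk_norm k t ^ n)"
    using taylor_coordinates[OF P V(2), of "[]" n k k v] by (simp add: dir_deriv_Nil)
  show ?thesis
    using near boolean[OF order_refl] boolean_taylor binomial binomial_taylor
    unfolding ordered_partitions_def decompositions_def by blast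
qed

end
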